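(* For every integer $r > 7000$ we have $\pi_{K_{r,r}}(\mathcal T_{2r}) = \frac12$, where $\mathcal T_{2r}$ is the family of spanning trees on $2r$ vertices (i.e. all trees with $2r$ vertices) and $K_{r,r}$ is the complete bipartite graph with $r$ vertices on each side.
   Context: Graphs are finite and simple. Let $H$ be a graph on vertex set $\{v_1,\dots,v_m\}$. An $H$-partite graph $G$ is a graph with a vertex partition $V=V_1\sqcup\dots\sqcup V_m$ into nonempty parts such that there are no edges inside any part, and no edges between $V_i$ and $V_j$ unless $v_iv_j\in E(H)$. For disjoint nonempty vertex sets $X,Y$, the edge density is $d(X,Y)=\frac{e(X,Y)}{|X||Y|}$, where $e(X,Y)$ is the number of edges between $X$ and $Y$. The $H$-partite density of $G$ is $d_H(G)=\min\{d(V_i,V_j): 1\le i<j\le m,\ v_iv_j\in E(H)\}$. A traversal of $G$ is a subgraph (on $m$ vertices) containing exactly one vertex from each part. For a family $\mathcal F$ of graphs, $G$ contains an $\mathcal F$-traversal if some traversal of $G$ contains a member of $\mathcal F$ as a subgraph (up to isomorphism); thus a $\mathcal T_m$-traversal is the same as a connected traversal. The critical density is $$\pi_H(\mathcal F)=\sup\{\alpha\in[0,1]: \text{there exists an } H\text{-partite graph } G \text{ with } d_H(G)\ge\alpha \text{ and no } \mathcal F\text{-traversal}\}.$$ *)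

theory Defs
  imports Complex_Main "HOL-Library.Disjoint_Sets" "Graph_Theory.Graph_Theory"
begin

text \<open>
  Finite simple graphs are the locale predicate \<^const>\<open>pair_graph\<close>: finite, symmetric, loopfree
  digraphs whose arcs are pairs, so that an edge is represented by its two orientations.
\<close>

definition contains_copy :: "'a pair_pre_digraph \<Rightarrow> 'b pair_pre_digraph \<Rightarrow> bool" where
  "contains_copy S F \<longleftrightarrow>
     (\<exists>F'. pair_graph F' \<and> subgraph (with_proj F') (with_proj S) \<and>
           digraph_iso (with_proj F) (with_proj F'))"

text \<open>
  The parts of an \<open>H\<close>-partite graph are indexed directly by the vertices of \<open>H\<close>: the part of
  \<open>v\<close> is \<open>V v\<close>, and \<open>V\<close> is irrelevant outside \<open>pverts H\<close>.
\<close>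

definition partite_graph ::
    "'v pair_pre_digraph \<Rightarrow> 'a pair_pre_digraph \<Rightarrow> ('v \<Rightarrow> 'a set) \<Rightarrow> bool" where
  "partite_graph H G V \<longleftrightarrow>
     pair_graph G \<and>
     pverts G = (\<Union>v\<in>pverts H. V v) \<and>
     disjoint_family_on V (pverts H) \<and>
     (\<forall>v\<in>pverts H. V v \<noteq> {}) \<and>
     (\<forall>v\<in>pverts H. parcs G \<inter> V v \<times> V v = {}) \<and>
     (\<forall>u\<in>pverts H. \<forall>v\<in>pverts H. u \<noteq> v \<and> (u, v) \<notin> parcs H \<longrightarrow> parcs G \<inter> V u \<times> V v = {})"

text \<open>
  For disjoint \<open>X\<close> and \<open>Y\<close>, each edge between them has exactly one orientation in \<open>X \<times> Y\<close>.
\<close>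

definition edge_density :: "'a pair_pre_digraph \<Rightarrow> 'a set \<Rightarrow> 'a set \<Rightarrow> real" where
  "edge_density G X Y = real (card (parcs G \<inter> X \<times> Y)) / (real (card X) * real (card Y))"

text \<open>
  Both orientations of an edge of \<open>H\<close> give the same density. The minimum is meaningful only
  when \<open>H\<close> has an edge.
\<close>

definition partite_density ::
    "'v pair_pre_digraph \<Rightarrow> 'a pair_pre_digraph \<Rightarrow> ('v \<Rightarrow> 'a set) \<Rightarrow> real" where
  "partite_density H G V = Min ((\<lambda>(u, v). edge_density G (V u) (V v)) ` parcs H)"

definition traversal ::
    "'v pair_pre_digraph \<Rightarrow> 'a pair_pre_digraph \<Rightarrow> ('v \<Rightarrow> 'a set) \<Rightarrow> 'a pair_pre_digraph \<Rightarrow> bool" where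
  "traversal H G V S \<longleftrightarrow>
     pair_graph S \<and> subgraph (with_proj S) (with_proj G) \<and>
     (\<forall>v\<in>pverts H. \<exists>!x. x \<in> pverts S \<inter> V v)"

definition has_family_traversal ::
    "'v pair_pre_digraph \<Rightarrow> 'a pair_pre_digraph \<Rightarrow> ('v \<Rightarrow> 'a set) \<Rightarrow> 'b pair_pre_digraph set \<Rightarrow> bool" where
  "has_family_traversal H G V \<F> \<longleftrightarrow> (\<exists>S. traversal H G V S \<and> (\<exists>F\<in>\<F>. contains_copy S F))"

text \<open>
  Every finite graph has an isomorphic copy with vertices in \<^typ>\<open>nat\<close>, so letting \<open>G\<close> range over
  graphs on natural numbers is no restriction.
\<close>

definition critical_density :: "'v pair_pre_digraph \<Rightarrow> 'b pair_pre_digraph set \<Rightarrow> real" where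
  "critical_density H \<F> =
     Sup {\<alpha> \<in> {0..1}. \<exists>(G :: nat pair_pre_digraph) V.
            partite_graph H G V \<and> partite_density H G V \<ge> \<alpha> \<and> \<not> has_family_traversal H G V \<F>}"

text \<open>
  The constants \<^const>\<open>forest\<close> and \<^const>\<open>tree\<close> are unsuitable for graphs encoded as symmetric
  digraphs, because \<^const>\<open>pre_digraph.cycle\<close> counts the walk \<open>a, b, a\<close> as a cycle. The cycles of
  a simple graph are those of length at least 3. Up to isomorphism, vertices in \<^typ>\<open>nat\<close> suffice.
\<close>

definition trees :: "nat \<Rightarrow> nat pair_pre_digraph set" where
  "trees m = {T. pair_graph T \<and> card (pverts T) = m \<and> Digraph_Component.connected (with_proj T) \<and>
                 \<not> (\<exists>p. pre_digraph.cycle (with_proj T) p \<and> length p \<ge> 3)}"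

end

theory Submission
  imports Defs
begin

text \<open>
  For the upper bound assume all densities between the rows \<open>V i\<close> and the columns \<open>V j\<close> exceed
  \<open>1/2\<close>. The degree of \<open>x\<close> is the expected number of neighbours of \<open>x\<close> in a random choice of one
  vertex from every column, and its average over each row exceeds \<open>r/2\<close>. Let \<open>x\<^sub>1\<close> be a row vertex of
  maximal degree \<open>\<Delta>\<close>, and call two vertices linked if their expected number of common neighbours is
  at least \<open>r/100\<close>. If in every other row more than half of the vertices are linked to \<open>x\<^sub>1\<close>, choose
  the column vertices at random among the neighbours of \<open>x\<^sub>1\<close>: they hit any linked vertices chosen
  in the rows, and the columns without a neighbour of \<open>x\<^sub>1\<close> are served by suitable linked vertices.
  Otherwise an averaging argument gives a vertex \<open>x\<^sub>0\<close> of degree exceeding \<open>r - \<Delta>\<close> that is not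
  linked to \<open>x\<^sub>1\<close>; the two have a common neighbour, and every vertex of degree above \<open>3r/100\<close> is
  linked to one of them. If \<open>\<Delta> \<le> 97r/100\<close>, these make up more than half of each row, and the same
  random choice works. By symmetry there remains the case of a row vertex and a column vertex of
  degree above \<open>97r/100\<close> each. They are joined by a path of length three, and random choices among
  their neighbours on both sides finish the proof.

  For the lower bound, a graph of density \<open>1/2\<close> may itself be disconnected: all rows are single
  vertices, each column has two vertices, and one row sees only the first of each pair, the others
  only the second.
\<close>

section \<open>Random choices and majorities\<close>

text \<open>A union bound in counting form: by 1 - x \<le> exp (- x), the choices that miss
  \<open>Y t k\<close> for every \<open>k\<close> make up at most the fraction exp (- \<mu>) of all
  choices, so by \<open>small\<close> the bad choices for all \<open>t\<close> together do not
  exhaust them.\<close>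

lemma hitting_choice:
  fixes X :: "'k \<Rightarrow> 'x set" and Y :: "'t \<Rightarrow> 'k \<Rightarrow> 'x set" and \<mu> :: real
  assumes "finite K" "finite T"
    and X: "\<And>k. k \<in> K \<Longrightarrow> finite (X k) \<and> X k \<noteq> {}"
    and Y: "\<And>t k. t \<in> T \<Longrightarrow> k \<in> K \<Longrightarrow> Y t k \<subseteq> X k"
    and sum: "\<And>t. t \<in> T \<Longrightarrow> \<mu> \<le> (\<Sum>k\<in>K. real (card (Y t k)) / real (card (X k)))"
    and small: "real (card T) * exp (- \<mu>) < 1"
  obtains g where "\<And>k. k \<in> K \<Longrightarrow> g k \<in> X k" "\<And>t. t \<in> T \<Longrightarrow> \<exists>k\<in>K. g k \<in> Y t k"
proof -
  define bad where "bad t = (\<Pi>\<^sub>E k\<in>K. X k - Y t k)" for t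
  define all where "all = (\<Pi>\<^sub>E k\<in>K. X k)"
  have pos: "real (card (X k)) > 0" if "k \<in> K" for k
    using X[OF that] by (simp add: card_gt_0_iff)
  have card_all: "real (card all) = (\<Prod>k\<in>K. real (card (X k)))"
    unfolding all_def using \<open>finite K\<close> by (simp add: card_PiE)
  have all_pos: "real (card all) > 0"
    unfolding card_all by (rule prod_pos) (use pos in auto)
  have card_bad: "real (card (bad t)) \<le> real (card all) * exp (- \<mu>)" if t: "t \<in> T" for t
  proof -
    have "real (card (bad t)) = (\<Prod>k\<in>K. real (card (X k - Y t k)))"
      unfolding bad_def using \<open>finite K\<close> by (simp add: card_PiE)
    also have "\<dots> \<le> (\<Prod>k\<in>K. real (card (X k)) * exp (- (real (card (Y t k)) / real (card (X k)))))"
    proof (rule prod_mono, rule conjI)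
      fix k assume k: "k \<in> K"
      have "real (card (X k - Y t k)) = real (card (X k)) - real (card (Y t k))"
        using Y[OF t k] X[OF k] by (simp add: card_Diff_subset finite_subset card_mono)
      also have "\<dots> = real (card (X k)) * (1 + - (real (card (Y t k)) / real (card (X k))))"
        using pos[OF k] by (simp add: field_simps)
      also have "\<dots> \<le> real (card (X k)) * exp (- (real (card (Y t k)) / real (card (X k))))"
        by (intro mult_left_mono exp_ge_add_one_self) auto
      finally show "real (card (X k - Y t k))
          \<le> real (card (X k)) * exp (- (real (card (Y t k)) / real (card (X k))))" .
    qed auto
    also have "\<dots> = real (card all) * exp (- (\<Sum>k\<in>K. real (card (Y t k)) / real (card (X k))))"
      using \<open>finite K\<close> by (simp add: prod.distrib card_all exp_sum sum_negf flip: exp_sum)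
    also have "\<dots> \<le> real (card all) * exp (- \<mu>)"
      using sum[OF t] by (intro mult_left_mono) auto
    finally show ?thesis .
  qed
  have "real (card (\<Union>t\<in>T. bad t)) \<le> (\<Sum>t\<in>T. real (card (bad t)))"
    using card_UN_le[OF \<open>finite T\<close>, of bad] by (metis of_nat_le_iff of_nat_sum)
  also have "\<dots> \<le> real (card T) * (real (card all) * exp (- \<mu>))"
    using sum_bounded_above[of T "\<lambda>t. real (card (bad t))"] card_bad by simp
  also have "\<dots> < real (card all)"
    using mult_strict_left_mono[OF small all_pos] by (simp add: algebra_simps)
  finally have "card (\<Union>t\<in>T. bad t) < card all" by simp
  moreover have "finite (\<Union>t\<in>T. bad t)"
    using assms(1,2) X unfolding bad_def by (auto intro!: finite_PiE)
  ultimately obtain g where g: "g \<in> all" "g \<notin> (\<Union>t\<in>T. bad t)"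
    by (metis card_mono linorder_not_le subsetI)
  show ?thesis
  proof (rule that)
    show "g k \<in> X k" if "k \<in> K" for k using g(1) that by (auto simp: all_def)
    show "\<exists>k\<in>K. g k \<in> Y t k" if "t \<in> T" for t
      using g that by (fastforce simp: all_def bad_def PiE_iff)
  qed
qed

text \<open>If at most half of \<open>S\<close> lay above \<open>a\<close>, the sum would be bounded
  by the case of half of the values equal to \<open>b\<close> and half equal to \<open>a\<close>,
  which gives at most s / 2 times the size of \<open>S\<close>.\<close>

lemma majority_above:
  fixes f :: "'x \<Rightarrow> real"
  assumes "finite S" and sum: "s / 2 * real (card S) < sum f S"
    and ub: "\<And>x. x \<in> S \<Longrightarrow> f x \<le> b" and "a \<le> b" "a + b \<le> s"
  shows "real (card S) / 2 < real (card {x\<in>S. a < f x})"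
proof (rule ccontr)
  assume "\<not> ?thesis"
  define T where "T = {x\<in>S. a < f x}"
  define U where "U = {x\<in>S. f x \<le> a}"
  have ST: "S = T \<union> U" "T \<inter> U = {}" "finite T" "finite U"
    using \<open>finite S\<close> by (auto simp: T_def U_def)
  have T: "real (card T) \<le> real (card S) / 2" using \<open>\<not> _\<close> by (simp add: T_def)
  have card: "real (card S) = real (card T) + real (card U)"
    using ST by (metis card_Un_disjoint of_nat_add)
  have "sum f S = sum f T + sum f U" using ST by (metis sum.union_disjoint)
  also have "\<dots> \<le> real (card T) * b + real (card U) * a"
    by (intro add_mono sum_bounded_above) (auto simp: T_def U_def ub)
  \<comment> \<open>Isolates the deviation from an even split, which is nonpositive, while its
    coefficient \<open>b - a\<close> is nonnegative.\<close>
  also have "\<dots> = (real (card T) - real (card S) / 2) * (b - a) + real (card S) / 2 * (a + b)"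
    unfolding card by (simp add: field_simps)
  also have "\<dots> \<le> 0 + real (card S) / 2 * s"
    using T assms(4,5) by (intro add_mono mult_left_mono mult_nonpos_nonneg) auto
  finally show False using sum by (simp add: mult.commute)
qed

text \<open>Pigeonhole, with only \<open>B\<close> a strict majority: in one application
  \<open>A\<close> is the complement of a set known to fill at most half of a row.\<close>

lemma majorities_intersect:
  assumes "finite S" "A \<subseteq> S" "B \<subseteq> S"
    and "real (card S) / 2 \<le> real (card A)" "real (card S) / 2 < real (card B)"
  shows "A \<inter> B \<noteq> {}"
proof
  assume "A \<inter> B = {}"
  then have "card A + card B = card (A \<union> B)"
    using assms(1-3) by (metis card_Un_disjoint finite_subset)
  also have "\<dots> \<le> card S" using assms(1-3) by (intro card_mono) auto
  finally show False using assms(4,5) by linarith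
qed

section \<open>Connected choices in blow-ups of complete bipartite graphs\<close>

text \<open>The relation lives on the indices of the parts rather than on the chosen vertices, so
  enlarging the index set preserves reachability (\<open>reach_mono\<close>).\<close>

definition link :: "('a \<Rightarrow> 'a \<Rightarrow> bool) \<Rightarrow> ('v \<Rightarrow> 'a) \<Rightarrow> 'v set \<Rightarrow> ('v \<times> 'v) set" where
  "link E f P = {(p, q) \<in> P \<times> P. E (f p) (f q)}"

text \<open>As \<open>E\<close> will be symmetric, reachability from one root \<open>z\<close>
  expresses that the chosen vertices induce a connected graph.\<close>

definition connected_choice :: "('a \<Rightarrow> 'a \<Rightarrow> bool) \<Rightarrow> ('v \<Rightarrow> 'a set) \<Rightarrow> 'v set \<Rightarrow> bool" where
  "connected_choice E V P \<longleftrightarrow>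
     (\<exists>f. (\<forall>p\<in>P. f p \<in> V p) \<and> (\<exists>z\<in>P. \<forall>p\<in>P. (z, p) \<in> (link E f P)\<^sup>*))"

lemma reach_step:
  assumes "(z, p) \<in> (link E f P)\<^sup>*" "p \<in> P" "q \<in> P" "E (f p) (f q)"
  shows "(z, q) \<in> (link E f P)\<^sup>*"
  using assms by (auto simp: link_def intro: rtrancl_into_rtrancl)

lemma reach_mono:
  assumes "(z, p) \<in> (link E f C)\<^sup>*" "C \<subseteq> P" "\<And>q. q \<in> C \<Longrightarrow> g q = f q"
  shows "(z, p) \<in> (link E g P)\<^sup>*"
proof -
  have "link E f C \<subseteq> link E g P" using assms(2,3) by (auto simp: link_def)
  then show ?thesis using rtrancl_mono assms(1) by blast
qed

section \<open>Expected degrees and codegrees\<close>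

locale blowup =
  fixes E :: "'a \<Rightarrow> 'a \<Rightarrow> bool" and V :: "'v \<Rightarrow> 'a set" and I J :: "'v set" and r :: nat
  assumes E_sym: "E x y \<longleftrightarrow> E y x"
    and fin: "finite I" "finite J" and card_IJ: "card I = r" "card J = r"
    and disj: "I \<inter> J = {}"
    and fin_V: "p \<in> I \<union> J \<Longrightarrow> finite (V p)"
    and ne_V: "p \<in> I \<union> J \<Longrightarrow> V p \<noteq> {}"
    and dense: "i \<in> I \<Longrightarrow> j \<in> J \<Longrightarrow>
      real (card (V i)) * real (card (V j)) / 2 < real (card {(x, y) \<in> V i \<times> V j. E x y})"
begin

text \<open>The hypotheses treat rows \<open>I\<close> and columns \<open>J\<close> alike, so every
  result on row vertices is also available for column vertices.\<close>

lemma swapped: "blowup E V J I r"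
proof
  fix j i assume ji: "j \<in> J" "i \<in> I"
  have "{(x, y) \<in> V j \<times> V i. E x y} = prod.swap ` {(x, y) \<in> V i \<times> V j. E x y}"
    by (auto simp: E_sym image_iff)
  then have "card {(x, y) \<in> V j \<times> V i. E x y} = card {(x, y) \<in> V i \<times> V j. E x y}"
    by (simp add: card_image)
  then show "real (card (V j)) * real (card (V i)) / 2 < real (card {(x, y) \<in> V j \<times> V i. E x y})"
    using dense[OF ji(2,1)] by (simp add: mult.commute)
qed (use E_sym fin card_IJ disj fin_V ne_V in auto)

definition nb :: "'a \<Rightarrow> 'v \<Rightarrow> 'a set" where
  "nb x p = {y \<in> V p. E x y}"

text \<open>For \<open>X\<close> inside \<open>V p\<close>, the probability that a uniformly random
  vertex of \<open>V p\<close> lies in \<open>X\<close>.\<close>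

definition share :: "'v \<Rightarrow> 'a set \<Rightarrow> real" where
  "share p X = real (card X) / real (card (V p))"

text \<open>Only columns are counted, so this and \<open>codeg\<close> are meant for row vertices;
  column vertices get theirs from the swapped locale.\<close>

definition deg :: "'a \<Rightarrow> real" where
  "deg x = (\<Sum>j\<in>J. share j (nb x j))"

definition codeg :: "'a \<Rightarrow> 'a \<Rightarrow> real" where
  "codeg x y = (\<Sum>j\<in>J. share j (nb x j \<inter> nb y j))"

lemma nb_subset: "nb x p \<subseteq> V p"
  by (auto simp: nb_def)

lemma card_V_pos: "p \<in> I \<union> J \<Longrightarrow> 0 < card (V p)"
  using fin_V ne_V by (simp add: card_gt_0_iff)

lemma share_nonneg: "0 \<le> share p X"
  by (simp add: share_def)

lemma share_le_1: "p \<in> I \<union> J \<Longrightarrow> X \<subseteq> V p \<Longrightarrow> share p X \<le> 1"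
  using card_V_pos[of p] card_mono[OF fin_V] by (simp add: share_def)

lemma share_mono: "p \<in> I \<union> J \<Longrightarrow> Y \<subseteq> V p \<Longrightarrow> X \<subseteq> Y \<Longrightarrow> share p X \<le> share p Y"
  using finite_subset[OF _ fin_V] by (auto simp: share_def intro!: divide_right_mono card_mono)

lemma share_Un_Int:
  assumes "p \<in> I \<union> J" "X \<subseteq> V p" "Y \<subseteq> V p"
  shows "share p (X \<union> Y) + share p (X \<inter> Y) = share p X + share p Y"
proof -
  have "card X + card Y = card (X \<union> Y) + card (X \<inter> Y)"
    using assms fin_V by (intro card_Un_Int) (auto intro: finite_subset)
  then show ?thesis
    by (simp add: share_def flip: add_divide_distrib of_nat_add)
qed

text \<open>Counts the edges between the two parts by their endpoint in \<open>V i\<close>, then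
  divides by the size of \<open>V j\<close>.\<close>

lemma sum_share_nb:
  assumes "i \<in> I" "j \<in> J"
  shows "real (card (V i)) / 2 < (\<Sum>x\<in>V i. share j (nb x j))"
proof -
  have "{(x, y) \<in> V i \<times> V j. E x y} = (SIGMA x:V i. nb x j)" by (auto simp: nb_def)
  then have "card {(x, y) \<in> V i \<times> V j. E x y} = (\<Sum>x\<in>V i. card (nb x j))"
    using assms fin_V by (auto simp: nb_def)
  then have "real (card {(x, y) \<in> V i \<times> V j. E x y}) / real (card (V j)) = (\<Sum>x\<in>V i. share j (nb x j))"
    by (simp add: share_def sum_divide_distrib)
  moreover have "real (card (V i)) / 2 < real (card {(x, y) \<in> V i \<times> V j. E x y}) / real (card (V j))"
    using dense[OF assms] card_V_pos[of j] assms by (simp add: field_simps)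
  ultimately show ?thesis by simp
qed

lemma sum_deg:
  assumes "i \<in> I"
  shows "real r / 2 * real (card (V i)) < sum deg (V i)"
proof -
  have "J \<noteq> {}" using assms card_IJ fin by auto
  have "real r / 2 * real (card (V i)) = (\<Sum>j\<in>J. real (card (V i)) / 2)"
    by (simp add: card_IJ)
  also have "\<dots> < (\<Sum>j\<in>J. \<Sum>x\<in>V i. share j (nb x j))"
    using sum_share_nb[OF assms] fin \<open>J \<noteq> {}\<close> by (intro sum_strict_mono) auto
  also have "\<dots> = sum deg (V i)" unfolding deg_def by (rule sum.swap)
  finally show ?thesis .
qed

lemma ex_deg_gt:
  assumes "i \<in> I"
  obtains x where "x \<in> V i" "real r / 2 < deg x"
proof -
  have "\<exists>x\<in>V i. real r / 2 < deg x"
  proof (rule ccontr)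
    assume "\<not> ?thesis"
    then have "sum deg (V i) \<le> real (card (V i)) * (real r / 2)"
      by (intro sum_bounded_above) (auto simp: not_less)
    then show False using sum_deg[OF assms] by (simp add: mult.commute)
  qed
  then show ?thesis using that by blast
qed

text \<open>The shares of the neighbourhoods in \<open>V j\<close> average more than 1/2 and are at
  most 1, so more than half of \<open>V i\<close> has a neighbour there
  (\<open>majority_above\<close> with threshold 0). This majority meets \<open>G\<close>.\<close>

lemma majority_adjacent:
  assumes "i \<in> I" "j \<in> J" "G \<subseteq> V i" "real (card (V i)) / 2 < real (card G)"
  obtains x y where "x \<in> G" "y \<in> V j" "E x y"
proof -
  have "real (card (V i)) / 2 < real (card {x\<in>V i. 0 < share j (nb x j)})"
    using assms sum_share_nb[OF assms(1,2)] fin_V share_le_1 nb_subset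
    by (intro majority_above[where s = 1 and b = 1]) auto
  then have "G \<inter> {x\<in>V i. 0 < share j (nb x j)} \<noteq> {}"
    using assms fin_V by (intro majorities_intersect[of "V i"]) auto
  then obtain x where "x \<in> G" "0 < share j (nb x j)" by auto
  then have "nb x j \<noteq> {}" by (auto simp: share_def)
  then show ?thesis using that \<open>x \<in> G\<close> by (auto simp: nb_def)
qed

text \<open>In some column the shares of the two neighbourhoods add up to more than 1, so they
  overlap there.\<close>

lemma common_neighbour:
  assumes "real r < deg x + deg y"
  obtains j w where "j \<in> J" "w \<in> V j" "E x w" "E y w"
proof -
  have "\<exists>j\<in>J. 1 < share j (nb x j) + share j (nb y j)"
  proof (rule ccontr)
    assume "\<not> ?thesis"
    then have "(\<Sum>j\<in>J. share j (nb x j) + share j (nb y j)) \<le> real (card J) * 1"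
      by (intro sum_bounded_above) (auto simp: not_less)
    then show False using assms by (simp add: deg_def sum.distrib card_IJ)
  qed
  then obtain j where j: "j \<in> J" "1 < share j (nb x j) + share j (nb y j)" by blast
  then have "0 < share j (nb x j \<inter> nb y j)"
    using share_Un_Int[of j "nb x j" "nb y j"] share_le_1[of j "nb x j \<union> nb y j"] nb_subset by fastforce
  then have "nb x j \<inter> nb y j \<noteq> {}" by (auto simp: share_def)
  then show ?thesis using that[OF j(1)] by (auto simp: nb_def)
qed

text \<open>Inclusion-exclusion in each column: the part of the neighbourhood of \<open>x\<close>
  outside those of \<open>u\<close> and \<open>v\<close> lies in the complement of their union. If
  \<open>u\<close> and \<open>v\<close> have degree sum above \<open>r\<close> but few common
  neighbours, any \<open>x\<close> of moderate degree has many common neighbours with one of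
  them.\<close>

lemma deg_le_codegs:
  "deg x \<le> codeg x u + codeg x v + real r - deg u - deg v + codeg u v"
proof -
  have "deg x + deg u + deg v
      \<le> (\<Sum>j\<in>J. share j (nb x j \<inter> nb u j) + share j (nb x j \<inter> nb v j) + share j (nb u j \<inter> nb v j) + 1)"
    unfolding deg_def sum.distrib[symmetric]
  proof (rule sum_mono)
    fix j assume j: "j \<in> J"
    let ?x = "nb x j" and ?u = "nb u j" and ?v = "nb v j"
    have sub: "?x \<subseteq> V j" "?u \<subseteq> V j" "?v \<subseteq> V j" "?u \<union> ?v \<subseteq> V j" "?x \<inter> ?u \<subseteq> V j" "?x \<inter> ?v \<subseteq> V j"
      using nb_subset by blast+
    have "share j ?x + share j (?u \<union> ?v) = share j (?x \<union> (?u \<union> ?v)) + share j (?x \<inter> (?u \<union> ?v))"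
      using share_Un_Int[of j ?x "?u \<union> ?v"] j sub by simp
    moreover have "share j (?x \<union> (?u \<union> ?v)) \<le> 1" using j sub by (intro share_le_1) auto
    moreover have "share j ((?x \<inter> ?u) \<union> (?x \<inter> ?v)) \<le> share j (?x \<inter> ?u) + share j (?x \<inter> ?v)"
      using share_Un_Int[of j "?x \<inter> ?u" "?x \<inter> ?v"] share_nonneg[of j "(?x \<inter> ?u) \<inter> (?x \<inter> ?v)"] j sub
      by simp
    moreover have "share j (?u \<union> ?v) + share j (?u \<inter> ?v) = share j ?u + share j ?v"
      using share_Un_Int[of j ?u ?v] j sub by simp
    ultimately show "share j ?x + share j ?u + share j ?v
        \<le> share j (?x \<inter> ?u) + share j (?x \<inter> ?v) + share j (?u \<inter> ?v) + 1"
      by (simp add: Int_Un_distrib)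
  qed
  also have "\<dots> = codeg x u + codeg x v + codeg u v + real r"
    by (simp add: codeg_def sum.distrib card_IJ)
  finally show ?thesis by simp
qed


lemma codeg_commute: "codeg x y = codeg y x"
  by (simp add: codeg_def Int_commute)

text \<open>In each column the neighbourhoods overlap in at least the excess of their shares over
  1.\<close>

lemma codeg_ge: "deg x + deg y - real r \<le> codeg x y"
proof -
  have "deg x + deg y \<le> (\<Sum>j\<in>J. share j (nb x j \<inter> nb y j) + 1)"
    unfolding deg_def sum.distrib[symmetric]
  proof (rule sum_mono)
    fix j assume "j \<in> J"
    then show "share j (nb x j) + share j (nb y j) \<le> share j (nb x j \<inter> nb y j) + 1"
      using share_Un_Int[of j "nb x j" "nb y j"] share_le_1[of j "nb x j \<union> nb y j"] nb_subset
      by fastforce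
  qed
  also have "\<dots> = codeg x y + real r"
    by (simp add: codeg_def sum.distrib card_IJ)
  finally show ?thesis by simp
qed

text \<open>The columns in \<open>F\<close> will be fixed by a core, and excluding each of them
  costs at most 1. Enlarging the neighbourhood of \<open>y\<close> to \<open>X\<close> allows unions
  of neighbourhoods of several core vertices.\<close>

lemma codeg_le_sum_Diff:
  assumes "F \<subseteq> J" and sub: "\<And>j. j \<in> J \<Longrightarrow> nb y j \<subseteq> X j"
  shows "codeg x y - real (card F) \<le> (\<Sum>j\<in>J - F. share j (nb x j \<inter> X j))"
proof -
  have "codeg x y = (\<Sum>j\<in>J - F. share j (nb x j \<inter> nb y j)) + (\<Sum>j\<in>F. share j (nb x j \<inter> nb y j))"
    unfolding codeg_def using fin assms(1) by (simp add: sum.subset_diff)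
  also have "\<dots> \<le> (\<Sum>j\<in>J - F. share j (nb x j \<inter> X j)) + real (card F) * 1"
  proof (intro add_mono sum_mono sum_bounded_above)
    fix j assume "j \<in> J - F"
    then show "share j (nb x j \<inter> nb y j) \<le> share j (nb x j \<inter> X j)"
      using sub[of j] nb_subset[of x j] by (intro share_mono) auto
  next
    fix j assume "j \<in> F"
    then show "share j (nb x j \<inter> nb y j) \<le> 1"
      using assms(1) nb_subset[of x j] by (intro share_le_1) auto
  qed
  finally show ?thesis by simp
qed

text \<open>Columns with empty \<open>X j\<close> contribute nothing to the sum, and elsewhere
  drawing from \<open>X j\<close> instead of all of \<open>V j\<close> can only raise the
  probability of a hit. So \<open>hitting_choice\<close> applies to the columns with nonempty
  \<open>X j\<close>.\<close>

lemma choose_hitting: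
  assumes T: "finite T" "card T \<le> r"
    and X: "\<And>j. j \<in> J - F \<Longrightarrow> X j \<subseteq> V j"
    and hit: "\<And>t. t \<in> T \<Longrightarrow> \<mu> \<le> (\<Sum>j\<in>J - F. share j (nb (v t) j \<inter> X j))"
    and small: "real r * exp (- \<mu>) < 1"
  obtains g where "\<And>j. j \<in> J - F \<Longrightarrow> X j \<noteq> {} \<Longrightarrow> g j \<in> X j"
    and "\<And>t. t \<in> T \<Longrightarrow> \<exists>j\<in>J - F. X j \<noteq> {} \<and> E (v t) (g j)"
proof -
  define K where "K = {j\<in>J - F. X j \<noteq> {}}"
  have K: "K \<subseteq> J" by (auto simp: K_def)
  have fin_X: "finite (X j)" if "j \<in> K" for j
    using that X[of j] fin_V[of j] by (auto simp: K_def intro: finite_subset)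
  obtain g where g: "\<And>j. j \<in> K \<Longrightarrow> g j \<in> X j" "\<And>t. t \<in> T \<Longrightarrow> \<exists>j\<in>K. g j \<in> nb (v t) j \<inter> X j"
  proof (rule hitting_choice[of K T X "\<lambda>t j. nb (v t) j \<inter> X j" \<mu>])
    show "finite K" using K fin by (auto intro: finite_subset)
    show "finite T" by fact
    show "finite (X j) \<and> X j \<noteq> {}" if "j \<in> K" for j using that fin_X by (auto simp: K_def)
    show "nb (v t) j \<inter> X j \<subseteq> X j" for t j by auto
    show "\<mu> \<le> (\<Sum>j\<in>K. real (card (nb (v t) j \<inter> X j)) / real (card (X j)))" if t: "t \<in> T" for t
    proof -
      have "(\<Sum>j\<in>J - F. share j (nb (v t) j \<inter> X j)) = (\<Sum>j\<in>K. share j (nb (v t) j \<inter> X j))"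
        using fin by (intro sum.mono_neutral_right) (auto simp: K_def share_def)
      also have "\<dots> \<le> (\<Sum>j\<in>K. real (card (nb (v t) j \<inter> X j)) / real (card (X j)))"
      proof (rule sum_mono)
        fix j assume j: "j \<in> K"
        then have "0 < card (X j)" "card (X j) \<le> card (V j)"
          using fin_X[OF j] X[of j] fin_V[of j] by (auto simp: K_def card_gt_0_iff intro: card_mono)
        then show "share j (nb (v t) j \<inter> X j) \<le> real (card (nb (v t) j \<inter> X j)) / real (card (X j))"
          unfolding share_def by (intro divide_left_mono) auto
      qed
      finally show ?thesis using hit[OF t] by simp
    qed
    have "real (card T) * exp (- \<mu>) \<le> real r * exp (- \<mu>)"
      using T(2) by (intro mult_right_mono) auto
    then show "real (card T) * exp (- \<mu>) < 1" using small by linarith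
  qed blast
  show ?thesis
  proof (rule that)
    show "g j \<in> X j" if "j \<in> J - F" "X j \<noteq> {}" for j using g(1) that by (auto simp: K_def)
    show "\<exists>j\<in>J - F. X j \<noteq> {} \<and> E (v t) (g j)" if "t \<in> T" for t
      using g(2)[OF that] by (auto simp: K_def nb_def)
  qed
qed

text \<open>Columns in which the core rows \<open>R\<close> have neighbours draw one of these at
  random; this attaches them to the core and hits the vertex selected in every remaining row. Each
  column without such neighbours is attached through a row of its own, whose selected vertex has a
  neighbour in that column.\<close>

lemma extend_core_one_sided:
  fixes f\<^sub>0 :: "'v \<Rightarrow> 'a" and R F :: "'v set"
  defines "X \<equiv> \<lambda>j. \<Union>u\<in>R. nb (f\<^sub>0 u) j"
  assumes RF: "R \<subset> I" "F \<subseteq> J"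
    and core: "\<And>p. p \<in> R \<union> F \<Longrightarrow> f\<^sub>0 p \<in> V p" "z \<in> R \<union> F"
      "\<And>p. p \<in> R \<union> F \<Longrightarrow> (z, p) \<in> (link E f\<^sub>0 (R \<union> F))\<^sup>*"
    and G: "\<And>i. i \<in> I - R \<Longrightarrow> G i \<subseteq> V i"
      "\<And>i. i \<in> I - R \<Longrightarrow> real (card (V i)) / 2 < real (card (G i))"
    and hit: "\<And>i x. i \<in> I - R \<Longrightarrow> x \<in> G i \<Longrightarrow> \<mu> \<le> (\<Sum>j\<in>J - F. share j (nb x j \<inter> X j))"
    and \<mu>: "real (card R) \<le> \<mu>" "real r * exp (- \<mu>) < 1"
  shows "connected_choice E V (I \<union> J)"
proof -
  define K where "K = {j\<in>J - F. X j \<noteq> {}}"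
  define B where "B = {j\<in>J - F. X j = {}}"
  have fins: "finite K" "finite B" "finite R" "finite (I - R)"
    using fin RF by (auto simp: K_def B_def intro: finite_subset)
  have X_sub: "X j \<subseteq> V j" for j using nb_subset by (auto simp: X_def)
  have G_ne: "G i \<noteq> {}" if "i \<in> I - R" for i using G(2)[OF that] by auto
  \<comment> \<open>Each column of \<open>K\<close> contributes at most 1 to the sum in
    \<open>hit\<close>, so there are at least \<mu> of them. Hence \<open>B\<close> has at most as
    many columns as there are rows outside \<open>R\<close>, which yields the injection
    \<open>h\<close>.\<close>
  have "real (card R) \<le> real (card K)"
  proof -
    obtain i x where ix: "i \<in> I - R" "x \<in> G i" using RF(1) G_ne by blast
    have "(\<Sum>j\<in>J - F. share j (nb x j \<inter> X j)) = (\<Sum>j\<in>K. share j (nb x j \<inter> X j))"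
      using fin by (intro sum.mono_neutral_right) (auto simp: K_def share_def)
    also have "\<dots> \<le> real (card K) * 1"
      using nb_subset[of x] by (intro sum_bounded_above share_le_1) (auto simp: K_def)
    finally show ?thesis using hit[OF ix] \<mu>(1) by simp
  qed
  moreover have "card B + card K \<le> r"
  proof -
    have "card B + card K = card (B \<union> K)"
      using fins by (intro card_Un_disjoint[symmetric]) (auto simp: B_def K_def)
    also have "\<dots> \<le> card J" using fin by (intro card_mono) (auto simp: B_def K_def)
    finally show ?thesis by (simp add: card_IJ)
  qed
  moreover have "card (I - R) = r - card R"
    using RF fins by (simp add: card_Diff_subset card_IJ)
  ultimately have "card B \<le> card (I - R)" by linarith
  then obtain h where h: "h ` B \<subseteq> I - R" "inj_on h B"
    using card_le_inj[of B "I - R"] fins by auto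
  \<comment> \<open>The row vertices are fixed before the random draw: a row reserved by
    \<open>h\<close> takes a vertex of the majority \<open>G i\<close> adjacent to its column, any
    other row an arbitrary vertex of \<open>G i\<close>.\<close>
  have "\<exists>x\<in>G i. \<forall>j\<in>B. h j = i \<longrightarrow> (\<exists>y\<in>V j. E x y)" if i: "i \<in> I - R" for i
  proof (cases "i \<in> h ` B")
    case True
    then obtain j where j: "j \<in> B" "i = h j" by blast
    obtain x y where "x \<in> G i" "y \<in> V j" "E x y"
      using majority_adjacent[of i j "G i"] i j G by (auto simp: B_def)
    then show ?thesis using j h(2) by (auto dest: inj_onD)
  qed (use G_ne[OF i] in blast)
  then obtain v where v: "\<And>i. i \<in> I - R \<Longrightarrow> v i \<in> G i"
    and v_adj: "\<And>i j. i \<in> I - R \<Longrightarrow> j \<in> B \<Longrightarrow> h j = i \<Longrightarrow> \<exists>y\<in>V j. E (v i) y"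
    by metis
  have "\<exists>y\<in>V j. E (v (h j)) y" if "j \<in> B" for j using v_adj[of "h j" j] that h(1) by auto
  then obtain w where w: "\<And>j. j \<in> B \<Longrightarrow> w j \<in> V j" "\<And>j. j \<in> B \<Longrightarrow> E (v (h j)) (w j)"
    by metis
  obtain g where g: "\<And>j. j \<in> J - F \<Longrightarrow> X j \<noteq> {} \<Longrightarrow> g j \<in> X j"
    and g_hit: "\<And>i. i \<in> I - R \<Longrightarrow> \<exists>j\<in>J - F. X j \<noteq> {} \<and> E (v i) (g j)"
  proof (rule choose_hitting[of "I - R" F X \<mu> v])
    show "card (I - R) \<le> r" using card_mono[of I "I - R"] fin card_IJ by auto
    show "\<mu> \<le> (\<Sum>j\<in>J - F. share j (nb (v i) j \<inter> X j))" if "i \<in> I - R" for i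
      using hit v that by blast
  qed (use fins \<mu> X_sub in auto)
  define f where "f p = (if p \<in> R \<union> F then f\<^sub>0 p else if p \<in> I then v p else if p \<in> K then g p else w p)" for p
  have f_core: "f p = f\<^sub>0 p" if "p \<in> R \<union> F" for p using that by (simp add: f_def)
  have f_I: "f i = v i" if "i \<in> I - R" for i using that disj RF by (auto simp: f_def)
  have f_K: "f j = g j" if "j \<in> K" for j using that disj RF by (auto simp: f_def K_def)
  have f_B: "f j = w j" if "j \<in> B" for j using that disj RF by (auto simp: f_def K_def B_def)
  have cover: "I \<union> J = (R \<union> F) \<union> (I - R) \<union> K \<union> B" using RF by (auto simp: K_def B_def)
  let ?L = "(link E f (I \<union> J))\<^sup>*"
  have reach_core: "(z, p) \<in> ?L" if "p \<in> R \<union> F" for p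
    using core(3)[OF that] RF by (rule_tac reach_mono[where f = f\<^sub>0 and C = "R \<union> F"]) (auto simp: f_core)
  have reach_K: "(z, j) \<in> ?L" if j: "j \<in> K" for j
  proof -
    obtain u where "u \<in> R" "E (f\<^sub>0 u) (g j)"
      using g[of j] j by (auto simp: K_def X_def nb_def)
    then have "E (f u) (f j)" using f_core[of u] f_K[OF j] by simp
    with \<open>u \<in> R\<close> show ?thesis
      using RF j by (intro reach_step[OF reach_core[of u]]) (auto simp: K_def)
  qed
  have reach_I: "(z, i) \<in> ?L" if i: "i \<in> I - R" for i
  proof -
    obtain j where j: "j \<in> K" "E (v i) (g j)" using g_hit[OF i] by (auto simp: K_def)
    then have "E (f j) (f i)" using f_I[OF i] f_K[OF j(1)] E_sym by metis
    then show ?thesis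
      using i j(1) by (intro reach_step[OF reach_K[OF j(1)]]) (auto simp: K_def)
  qed
  have reach_B: "(z, j) \<in> ?L" if j: "j \<in> B" for j
  proof -
    have hj: "h j \<in> I - R" using h(1) j by auto
    then have "E (f (h j)) (f j)" using w(2)[OF j] f_I[OF hj] f_B[OF j] by simp
    then show ?thesis
      using hj j by (intro reach_step[OF reach_I[OF hj]]) (auto simp: B_def)
  qed
  have "\<forall>p\<in>I \<union> J. f p \<in> V p"
  proof
    fix p assume "p \<in> I \<union> J"
    then consider "p \<in> R \<union> F" | "p \<in> I - R" | "p \<in> K" | "p \<in> B" using cover by blast
    then show "f p \<in> V p"
    proof cases
      case 1 then show ?thesis using core(1) f_core by simp
    next
      case 2 then show ?thesis using v G(1) f_I by auto
    next
      case 3 then show ?thesis using g[of p] X_sub f_K by (auto simp: K_def)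
    next
      case 4 then show ?thesis using w(1) f_B by simp
    qed
  qed
  moreover have "\<forall>p\<in>I \<union> J. (z, p) \<in> ?L"
    using reach_core reach_K reach_I reach_B cover by blast
  moreover have "z \<in> I \<union> J" using core(2) RF by auto
  ultimately show ?thesis unfolding connected_choice_def by blast
qed

text \<open>Columns draw among the neighbours of the core vertex \<open>f\<^sub>0 i\<^sub>1\<close>,
  rows among those of \<open>f\<^sub>0 j\<^sub>1\<close>. Parts without such neighbours use vertices
  \<open>w j\<close> and \<open>v i\<close> fixed in advance, which the draw on the opposite side
  hits.\<close>

lemma extend_core_two_sided:
  assumes RF: "R \<subseteq> I" "F \<subseteq> J" "i\<^sub>1 \<in> R" "j\<^sub>1 \<in> F"
    and core: "\<And>p. p \<in> R \<union> F \<Longrightarrow> f\<^sub>0 p \<in> V p" "z \<in> R \<union> F"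
      "\<And>p. p \<in> R \<union> F \<Longrightarrow> (z, p) \<in> (link E f\<^sub>0 (R \<union> F))\<^sup>*"
    and hit_I: "\<And>i. i \<in> I - R \<Longrightarrow> \<exists>x\<in>V i. \<mu> \<le> (\<Sum>j\<in>J - F. share j (nb x j \<inter> nb (f\<^sub>0 i\<^sub>1) j))"
    and hit_J: "\<And>j. j \<in> J - F \<Longrightarrow> \<exists>y\<in>V j. \<mu> \<le> (\<Sum>i\<in>I - R. share i (nb y i \<inter> nb (f\<^sub>0 j\<^sub>1) i))"
    and \<mu>: "real r * exp (- \<mu>) < 1"
  shows "connected_choice E V (I \<union> J)"
proof -
  interpret swap: blowup E V J I r by (rule swapped)
  let ?a = "f\<^sub>0 i\<^sub>1" and ?b = "f\<^sub>0 j\<^sub>1"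
  obtain v where v: "\<And>i. i \<in> I - R \<Longrightarrow> v i \<in> V i"
    "\<And>i. i \<in> I - R \<Longrightarrow> \<mu> \<le> (\<Sum>j\<in>J - F. share j (nb (v i) j \<inter> nb ?a j))"
    using hit_I by metis
  obtain w where w: "\<And>j. j \<in> J - F \<Longrightarrow> w j \<in> V j"
    "\<And>j. j \<in> J - F \<Longrightarrow> \<mu> \<le> (\<Sum>i\<in>I - R. share i (nb (w j) i \<inter> nb ?b i))"
    using hit_J by metis
  obtain g where g: "\<And>j. j \<in> J - F \<Longrightarrow> nb ?a j \<noteq> {} \<Longrightarrow> g j \<in> nb ?a j"
    and g_hit: "\<And>i. i \<in> I - R \<Longrightarrow> \<exists>j\<in>J - F. nb ?a j \<noteq> {} \<and> E (v i) (g j)"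
  proof (rule choose_hitting[of "I - R" F "nb ?a" \<mu> v])
    show "card (I - R) \<le> r" using card_mono[of I "I - R"] fin card_IJ by auto
  qed (use fin \<mu> nb_subset v in auto)
  obtain k where k: "\<And>i. i \<in> I - R \<Longrightarrow> nb ?b i \<noteq> {} \<Longrightarrow> k i \<in> nb ?b i"
    and k_hit: "\<And>j. j \<in> J - F \<Longrightarrow> \<exists>i\<in>I - R. nb ?b i \<noteq> {} \<and> E (w j) (k i)"
  proof (rule swap.choose_hitting[of "J - F" R "nb ?b" \<mu> w])
    show "card (J - F) \<le> r" using card_mono[of J "J - F"] fin card_IJ by auto
  qed (use fin \<mu> nb_subset w in auto)
  define K where "K = {j\<in>J - F. nb ?a j \<noteq> {}}"
  define L where "L = {i\<in>I - R. nb ?b i \<noteq> {}}"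
  \<comment> \<open>Rows in \<open>L\<close> and columns in \<open>K\<close> keep their random
    vertex; \<open>v\<close> and \<open>w\<close> are the fallback for the other parts.\<close>
  define f where "f p = (if p \<in> R \<union> F then f\<^sub>0 p else if p \<in> L then k p else if p \<in> K then g p
    else if p \<in> I then v p else w p)" for p
  have f_core: "f p = f\<^sub>0 p" if "p \<in> R \<union> F" for p using that by (simp add: f_def)
  have f_L: "f i = k i" if "i \<in> L" for i using that disj RF by (auto simp: f_def L_def)
  have f_K: "f j = g j" if "j \<in> K" for j using that disj RF by (auto simp: f_def K_def L_def)
  have f_I: "f i = v i" if "i \<in> I - R - L" for i using that disj RF by (auto simp: f_def K_def)
  have f_J: "f j = w j" if "j \<in> J - F - K" for j using that disj RF by (auto simp: f_def L_def)
  have cover: "I \<union> J = (R \<union> F) \<union> L \<union> K \<union> (I - R - L) \<union> (J - F - K)"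
    using RF by (auto simp: K_def L_def)
  let ?L = "(link E f (I \<union> J))\<^sup>*"
  have reach_core: "(z, p) \<in> ?L" if "p \<in> R \<union> F" for p
    using core(3)[OF that] RF by (rule_tac reach_mono[where f = f\<^sub>0 and C = "R \<union> F"]) (auto simp: f_core)
  have reach_K: "(z, j) \<in> ?L" if j: "j \<in> K" for j
  proof -
    have "E (f i\<^sub>1) (f j)" using RF f_core[of i\<^sub>1] f_K[OF j] g[of j] j by (simp add: K_def nb_def)
    then show ?thesis
      using RF j by (intro reach_step[OF reach_core[of i\<^sub>1]]) (auto simp: K_def)
  qed
  have reach_L: "(z, i) \<in> ?L" if i: "i \<in> L" for i
  proof -
    have "E (f j\<^sub>1) (f i)" using RF f_core[of j\<^sub>1] f_L[OF i] k[of i] i by (simp add: L_def nb_def)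
    then show ?thesis
      using RF i by (intro reach_step[OF reach_core[of j\<^sub>1]]) (auto simp: L_def)
  qed
  have reach_I: "(z, i) \<in> ?L" if i: "i \<in> I - R - L" for i
  proof -
    obtain j where j: "j \<in> K" "E (v i) (g j)" using g_hit[of i] i by (auto simp: K_def)
    then have "E (f j) (f i)" using f_I[OF i] f_K[OF j(1)] E_sym by metis
    then show ?thesis
      using i j(1) by (intro reach_step[OF reach_K[OF j(1)]]) (auto simp: K_def)
  qed
  have reach_J: "(z, j) \<in> ?L" if j: "j \<in> J - F - K" for j
  proof -
    obtain i where i: "i \<in> L" "E (w j) (k i)" using k_hit[of j] j by (auto simp: L_def)
    then have "E (f i) (f j)" using f_J[OF j] f_L[OF i(1)] E_sym by metis
    then show ?thesis
      using i(1) j by (intro reach_step[OF reach_L[OF i(1)]]) (auto simp: L_def)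
  qed
  have "\<forall>p\<in>I \<union> J. f p \<in> V p"
  proof
    fix p assume "p \<in> I \<union> J"
    then consider "p \<in> R \<union> F" | "p \<in> L" | "p \<in> K" | "p \<in> I - R - L" | "p \<in> J - F - K" using cover by blast
    then show "f p \<in> V p"
    proof cases
      case 1 then show ?thesis using core(1) f_core by simp
    next
      case 2 then show ?thesis using k[of p] nb_subset f_L by (auto simp: L_def)
    next
      case 3 then show ?thesis using g[of p] nb_subset f_K by (auto simp: K_def)
    next
      case 4 then show ?thesis using v(1) f_I by simp
    next
      case 5 then show ?thesis using w(1) f_J by simp
    qed
  qed
  moreover have "\<forall>p\<in>I \<union> J. (z, p) \<in> ?L"
    using reach_core reach_K reach_L reach_I reach_J cover by blast
  moreover have "z \<in> I \<union> J" using core(2) RF by auto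
  ultimately show ?thesis unfolding connected_choice_def by blast
qed

end

text \<open>The exponent is the link threshold \<open>r / 100\<close> less 2, the largest number of
  core columns or core rows excluded from a draw. The exponential is compared with a cubic through
  exp x = exp (x / 3) ^ 3 \<ge> (x / 3) ^ 3.\<close>

lemma exp_beats_linear:
  assumes "r > 7000"
  shows "real r * exp (- (real r / 100 - 2)) < 1"
proof -
  define x where "x = real r / 100 - 2"
  have x: "x \<ge> 68" "real r = 100 * x + 200" using assms by (auto simp: x_def)
  \<comment> \<open>\<open>68 / 3\<close> is a lower bound for \<open>x / 3\<close>; its square
    divided by 3 exceeds 171, which beats the slope 100.\<close>
  have "100 * x + 200 < x * (68 / 3) ^ 2 / 3" using x by (simp add: power2_eq_square)
  also have "\<dots> \<le> x * (x / 3) ^ 2 / 3"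
    using x by (intro divide_right_mono mult_left_mono power_mono) auto
  also have "\<dots> = (x / 3) ^ 3" by (simp add: power2_eq_square power3_eq_cube)
  also have "\<dots> \<le> exp (x / 3) ^ 3"
  proof (intro power_mono)
    show "x / 3 \<le> exp (x / 3)" using exp_ge_add_one_self[of "x / 3"] by linarith
  qed (use x in auto)
  also have "\<dots> = exp x" by (simp flip: exp_of_nat_mult)
  finally have "real r < exp x" using x by simp
  then show ?thesis unfolding x_def[symmetric] by (simp add: exp_minus field_simps)
qed

section \<open>Case analysis on the largest degrees\<close>

context blowup
begin

lemma max_degree_vertex:
  assumes "I \<noteq> {}"
  obtains i x where "i \<in> I" "x \<in> V i" "\<And>i' y. i' \<in> I \<Longrightarrow> y \<in> V i' \<Longrightarrow> deg y \<le> deg x"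
proof -
  have "finite (\<Union>i\<in>I. V i)" "(\<Union>i\<in>I. V i) \<noteq> {}" using fin fin_V ne_V assms by auto
  then obtain x where "x \<in> (\<Union>i\<in>I. V i)" "deg x = Max (deg ` (\<Union>i\<in>I. V i))"
    by (metis (no_types, lifting) Max_in finite_imageI image_iff image_is_empty)
  with \<open>finite _\<close> have "x \<in> (\<Union>i\<in>I. V i)" "\<And>y. y \<in> (\<Union>i\<in>I. V i) \<Longrightarrow> deg y \<le> deg x"
    by simp_all
  then show ?thesis using that by blast
qed

text \<open>The core is a row vertex of maximal degree, alone if it is linked to a majority of every
  other row, and otherwise joined by a common neighbour to a second row vertex. The cap serves the
  second case: it adds up with 3\<delta> to \<open>r\<close>, so \<open>majority_above\<close> puts
  more than half of each row above degree 3\<delta>.\<close>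

lemma connected_choice_if_degrees_bounded:
  assumes r: "r > 7000"
    and ub: "\<And>i x. i \<in> I \<Longrightarrow> x \<in> V i \<Longrightarrow> deg x \<le> 97 / 100 * real r"
  shows "connected_choice E V (I \<union> J)"
proof -
  define \<delta> where "\<delta> = real r / 100"
  \<comment> \<open>At most one core column is excluded in this proof; subtracting 2 gives the
    exponent of \<open>exp_beats_linear\<close>, which also serves cores with two columns.\<close>
  define \<mu> where "\<mu> = \<delta> - 2"
  have \<mu>: "\<mu> \<ge> 2" "real r * exp (- \<mu>) < 1"
    using r exp_beats_linear[OF r] by (simp_all add: \<mu>_def \<delta>_def)
  have "I \<noteq> {}" using r card_IJ by auto
  then obtain i\<^sub>1 x\<^sub>1 where x1: "i\<^sub>1 \<in> I" "x\<^sub>1 \<in> V i\<^sub>1"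
    and max: "\<And>i y. i \<in> I \<Longrightarrow> y \<in> V i \<Longrightarrow> deg y \<le> deg x\<^sub>1"
    using max_degree_vertex by blast
  obtain y where "y \<in> V i\<^sub>1" "real r / 2 < deg y" using ex_deg_gt[OF x1(1)] by blast
  with max[OF x1(1)] have half: "real r / 2 < deg x\<^sub>1" by (meson less_le_trans)
  have proper: "R \<subset> I" if "R \<subseteq> I" "card R \<le> 2" for R
  proof -
    have "card R \<noteq> card I" using that(2) r card_IJ(1) by linarith
    then show ?thesis using that(1) by blast
  qed
  show ?thesis
  proof (cases "\<forall>i\<in>I - {i\<^sub>1}. real (card (V i)) / 2 < real (card {x\<in>V i. \<delta> \<le> codeg x x\<^sub>1})")
    case True
    show ?thesis
    proof (rule extend_core_one_sided[where R = "{i\<^sub>1}" and F = "{}" and f\<^sub>0 = "\<lambda>_. x\<^sub>1" and z = i\<^sub>1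
          and G = "\<lambda>i. {x\<in>V i. \<delta> \<le> codeg x x\<^sub>1}"])
      show "{i\<^sub>1} \<subset> I" using x1 by (intro proper) auto
      fix i x assume "i \<in> I - {i\<^sub>1}" "x \<in> {x \<in> V i. \<delta> \<le> codeg x x\<^sub>1}"
      then show "\<mu> \<le> (\<Sum>j\<in>J - {}. share j (nb x j \<inter> (\<Union>u\<in>{i\<^sub>1}. nb x\<^sub>1 j)))"
        using codeg_le_sum_Diff[of "{}" x\<^sub>1 "nb x\<^sub>1" x] by (simp add: \<mu>_def)
    qed (use x1 True \<mu> in auto)
  next
    case False
    then obtain i\<^sub>0 where i0: "i\<^sub>0 \<in> I" "i\<^sub>0 \<noteq> i\<^sub>1"
      and few: "real (card {x\<in>V i\<^sub>0. \<delta> \<le> codeg x x\<^sub>1}) \<le> real (card (V i\<^sub>0)) / 2" by fastforce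
    \<comment> \<open>Maximality of \<open>deg x\<^sub>1\<close> provides the upper bound for
      \<open>majority_above\<close>, and \<open>half\<close> the ordering
      \<open>r - deg x\<^sub>1 \<le> deg x\<^sub>1\<close>.\<close>
    have "real (card (V i\<^sub>0)) / 2 < real (card {x\<in>V i\<^sub>0. real r - deg x\<^sub>1 < deg x})"
      using sum_deg[OF i0(1)] fin_V i0 max half by (intro majority_above[where s = "real r" and b = "deg x\<^sub>1"]) auto
    moreover have "real (card (V i\<^sub>0)) / 2 \<le> real (card {x\<in>V i\<^sub>0. codeg x x\<^sub>1 < \<delta>})"
    proof -
      have "V i\<^sub>0 = {x\<in>V i\<^sub>0. \<delta> \<le> codeg x x\<^sub>1} \<union> {x\<in>V i\<^sub>0. codeg x x\<^sub>1 < \<delta>}" by auto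
      then have "card (V i\<^sub>0) \<le> card {x\<in>V i\<^sub>0. \<delta> \<le> codeg x x\<^sub>1} + card {x\<in>V i\<^sub>0. codeg x x\<^sub>1 < \<delta>}"
        by (metis (no_types, lifting) card_Un_le)
      then show ?thesis using few by linarith
    qed
    ultimately have "{x\<in>V i\<^sub>0. codeg x x\<^sub>1 < \<delta>} \<inter> {x\<in>V i\<^sub>0. real r - deg x\<^sub>1 < deg x} \<noteq> {}"
      using fin_V[of i\<^sub>0] i0 by (intro majorities_intersect[of "V i\<^sub>0"]) auto
    then obtain x\<^sub>0 where x0: "x\<^sub>0 \<in> V i\<^sub>0" "codeg x\<^sub>0 x\<^sub>1 < \<delta>" "real r - deg x\<^sub>1 < deg x\<^sub>0" by auto
    then have "real r < deg x\<^sub>0 + deg x\<^sub>1" by simp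
    then obtain j w where jw: "j \<in> J" "w \<in> V j" "E x\<^sub>0 w" "E x\<^sub>1 w" using common_neighbour by blast
    have j_neq: "j \<noteq> i\<^sub>0" "j \<noteq> i\<^sub>1" using jw(1) i0(1) x1(1) disj by auto
    \<comment> \<open>The core is the path \<open>x\<^sub>1\<close>, \<open>w\<close>,
      \<open>x\<^sub>0\<close>; the default value \<open>w\<close> is the choice at
      \<open>j\<close>.\<close>
    define f\<^sub>0 where "f\<^sub>0 = (\<lambda>_. w)(i\<^sub>1 := x\<^sub>1, i\<^sub>0 := x\<^sub>0)"
    have f0: "f\<^sub>0 i\<^sub>1 = x\<^sub>1" "f\<^sub>0 i\<^sub>0 = x\<^sub>0" "f\<^sub>0 j = w" using i0 j_neq by (auto simp: f\<^sub>0_def)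
    let ?R = "{i\<^sub>1, i\<^sub>0}" and ?F = "{j}"
    let ?L = "(link E f\<^sub>0 (?R \<union> ?F))\<^sup>*"
    have "(i\<^sub>1, j) \<in> ?L" using jw by (auto simp: link_def f0)
    moreover from this have "(i\<^sub>1, i\<^sub>0) \<in> ?L" by (rule reach_step) (use E_sym[THEN iffD1, OF jw(3)] in \<open>auto simp: f0\<close>)
    ultimately have reach: "(i\<^sub>1, p) \<in> ?L" if "p \<in> ?R \<union> ?F" for p using that by auto
    show ?thesis
    proof (rule extend_core_one_sided[where R = ?R and F = ?F and f\<^sub>0 = f\<^sub>0 and z = i\<^sub>1
          and G = "\<lambda>i. {x\<in>V i. 3 * \<delta> < deg x}"])
      show "?R \<subset> I" using x1 i0 by (intro proper) auto
      show "real (card (V i)) / 2 < real (card {x\<in>V i. 3 * \<delta> < deg x})" if "i \<in> I - ?R" for i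
        using sum_deg[of i] fin_V[of i] that ub r
        by (intro majority_above[where s = "real r" and b = "97 / 100 * real r"]) (auto simp: \<delta>_def)
      fix i x assume "i \<in> I - ?R" "x \<in> {x\<in>V i. 3 * \<delta> < deg x}"
      \<comment> \<open>In \<open>deg_le_codegs\<close> the term
        \<open>r - deg x\<^sub>1 - deg x\<^sub>0\<close> is negative and the codegree of
        \<open>x\<^sub>1\<close> and \<open>x\<^sub>0\<close> is below \<delta>, so the two
        codegrees of \<open>x\<close> add up to more than 2\<delta>.\<close>
      then have "\<delta> \<le> codeg x x\<^sub>1 \<or> \<delta> \<le> codeg x x\<^sub>0"
        using deg_le_codegs[of x x\<^sub>1 x\<^sub>0] x0 codeg_commute[of x\<^sub>1 x\<^sub>0] by fastforce
      moreover have "codeg x y - 1 \<le> (\<Sum>j\<in>J - ?F. share j (nb x j \<inter> (\<Union>u\<in>?R. nb (f\<^sub>0 u) j)))"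
        if "y = x\<^sub>1 \<or> y = x\<^sub>0" for y
        using codeg_le_sum_Diff[of ?F y "\<lambda>j. \<Union>u\<in>?R. nb (f\<^sub>0 u) j" x] that jw(1) f0 by auto
      ultimately show "\<mu> \<le> (\<Sum>j\<in>J - ?F. share j (nb x j \<inter> (\<Union>u\<in>?R. nb (f\<^sub>0 u) j)))"
        unfolding \<mu>_def by fastforce
    qed (use x1 i0 x0 jw \<mu> reach f0 in auto)
  qed
qed

text \<open>If all columns other than \<open>j\<^sub>1\<close> had share below 3/4, the degree would
  be at most 1 + 3r/4. Column \<open>j\<^sub>1\<close> is excluded because the core already uses it
  for another vertex.\<close>

lemma large_share:
  assumes r: "r > 7000" and deg: "97 / 100 * real r < deg x" and "j\<^sub>1 \<in> J"
  obtains j where "j \<in> J" "j \<noteq> j\<^sub>1" "3 / 4 \<le> share j (nb x j)"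
proof -
  have "\<exists>j\<in>J - {j\<^sub>1}. 3 / 4 \<le> share j (nb x j)"
  proof (rule ccontr)
    assume "\<not> ?thesis"
    then have "(\<Sum>j\<in>J - {j\<^sub>1}. share j (nb x j)) \<le> real (card (J - {j\<^sub>1})) * (3 / 4)"
      by (intro sum_bounded_above) (meson less_imp_le not_le)
    moreover have "deg x = share j\<^sub>1 (nb x j\<^sub>1) + (\<Sum>j\<in>J - {j\<^sub>1}. share j (nb x j))"
      unfolding deg_def using assms(3) fin by (intro sum.remove) auto
    moreover have "share j\<^sub>1 (nb x j\<^sub>1) \<le> 1" using assms(3) nb_subset by (intro share_le_1) auto
    moreover have "card (J - {j\<^sub>1}) \<le> r" using card_mono[of J "J - {j\<^sub>1}"] fin card_IJ by auto
    ultimately show False using deg r by linarith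
  qed
  then show ?thesis using that by blast
qed

text \<open>\<open>A \<times> B\<close> contains at least 9/16 of all pairs, so without an edge in
  it the density would be at most 7/16.\<close>

lemma large_subsets_adjacent:
  assumes "i \<in> I" "j \<in> J" "A \<subseteq> V i" "B \<subseteq> V j" "3 / 4 \<le> share i A" "3 / 4 \<le> share j B"
  obtains x y where "x \<in> A" "y \<in> B" "E x y"
proof -
  have "\<exists>x\<in>A. \<exists>y\<in>B. E x y"
  proof (rule ccontr)
    assume "\<not> ?thesis"
    then have "{(x, y) \<in> V i \<times> V j. E x y} \<subseteq> V i \<times> V j - A \<times> B" by auto
    moreover have fins: "finite (V i)" "finite (V j)" "finite A" "finite B"
      using fin_V[of i] fin_V[of j] assms by (auto intro: finite_subset)
    ultimately have "card {(x, y) \<in> V i \<times> V j. E x y} \<le> card (V i \<times> V j - A \<times> B)"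
      by (intro card_mono) auto
    also have "\<dots> = card (V i) * card (V j) - card A * card B"
      using assms fins by (subst card_Diff_subset) (auto simp: card_cartesian_product)
    finally have "real (card {(x, y) \<in> V i \<times> V j. E x y}) \<le> real (card (V i) * card (V j) - card A * card B)"
      by simp
    also have "\<dots> = real (card (V i)) * real (card (V j)) - real (card A) * real (card B)"
      using assms fins by (simp add: card_mono mult_le_mono)
    also have "\<dots> \<le> real (card (V i)) * real (card (V j)) - (3 / 4 * real (card (V i))) * (3 / 4 * real (card (V j)))"
    proof -
      have "3 / 4 * real (card (V i)) \<le> real (card A)" "3 / 4 * real (card (V j)) \<le> real (card B)"
        using assms card_V_pos[of i] card_V_pos[of j] by (simp_all add: share_def field_simps)
      then have "(3 / 4 * real (card (V i))) * (3 / 4 * real (card (V j))) \<le> real (card A) * real (card B)"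
        by (intro mult_mono) auto
      then show ?thesis by linarith
    qed
    also have "\<dots> \<le> real (card (V i)) * real (card (V j)) / 2" by simp
    finally show False using dense[OF assms(1,2)] by linarith
  qed
  then show ?thesis using that by blast
qed

text \<open>The core is a path \<open>a\<close>, \<open>y\<close>, \<open>x\<close>,
  \<open>b\<close>, whose middle edge joins a large neighbourhood of \<open>a\<close> in one column
  to a large neighbourhood of \<open>b\<close> in one row. The term
  \<open>blowup.deg E V I b\<close> is the degree of the column vertex \<open>b\<close>, measured
  over the rows.\<close>

lemma connected_choice_if_large_degrees:
  assumes r: "r > 7000"
    and a: "i\<^sub>1 \<in> I" "a \<in> V i\<^sub>1" "97 / 100 * real r < deg a"
    and b: "j\<^sub>1 \<in> J" "b \<in> V j\<^sub>1" "97 / 100 * real r < blowup.deg E V I b"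
  shows "connected_choice E V (I \<union> J)"
proof -
  interpret swap: blowup E V J I r by (rule swapped)
  obtain j\<^sub>2 where j2: "j\<^sub>2 \<in> J" "j\<^sub>2 \<noteq> j\<^sub>1" "3 / 4 \<le> share j\<^sub>2 (nb a j\<^sub>2)"
    using large_share[OF r a(3) b(1)] by blast
  obtain i\<^sub>2 where i2: "i\<^sub>2 \<in> I" "i\<^sub>2 \<noteq> i\<^sub>1" "3 / 4 \<le> share i\<^sub>2 (nb b i\<^sub>2)"
    using swap.large_share[OF r b(3) a(1)] by blast
  obtain x y where "x \<in> nb b i\<^sub>2" "y \<in> nb a j\<^sub>2" and xy: "E x y"
    using large_subsets_adjacent[OF i2(1) j2(1) nb_subset nb_subset i2(3) j2(3)] by blast
  then have x: "x \<in> V i\<^sub>2" "E b x" and y: "y \<in> V j\<^sub>2" "E a y" by (simp_all add: nb_def)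
  have neq: "i\<^sub>1 \<noteq> j\<^sub>1" "i\<^sub>1 \<noteq> j\<^sub>2" "i\<^sub>2 \<noteq> j\<^sub>1" "i\<^sub>2 \<noteq> j\<^sub>2" using a(1) b(1) i2(1) j2(1) disj by auto
  define f\<^sub>0 where "f\<^sub>0 = (\<lambda>_. a)(i\<^sub>2 := x, j\<^sub>1 := b, j\<^sub>2 := y)"
  have f0: "f\<^sub>0 i\<^sub>1 = a" "f\<^sub>0 i\<^sub>2 = x" "f\<^sub>0 j\<^sub>1 = b" "f\<^sub>0 j\<^sub>2 = y"
    using i2(2) j2(2) neq by (auto simp: f\<^sub>0_def)
  let ?R = "{i\<^sub>1, i\<^sub>2}" and ?F = "{j\<^sub>1, j\<^sub>2}"
  let ?L = "(link E f\<^sub>0 (?R \<union> ?F))\<^sup>*"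
  have l1: "(i\<^sub>1, j\<^sub>2) \<in> ?L" using y by (auto simp: link_def f0)
  then have l2: "(i\<^sub>1, i\<^sub>2) \<in> ?L" by (rule reach_step) (use E_sym[THEN iffD1, OF xy] in \<open>auto simp: f0\<close>)
  then have l3: "(i\<^sub>1, j\<^sub>1) \<in> ?L" by (rule reach_step) (use E_sym[THEN iffD1, OF x(2)] in \<open>auto simp: f0\<close>)
  have reach: "(i\<^sub>1, p) \<in> ?L" if "p \<in> ?R \<union> ?F" for p using that l1 l2 l3 by auto
  define \<mu> where "\<mu> = real r / 100 - 2"
  \<comment> \<open>The codegree \<open>c\<close> is at least r/2 + 97r/100 - r = 47r/100, well
    above r/100; the 2 pays for the two excluded core columns or rows.\<close>
  have bound: "\<mu> \<le> c - 2" if "real r / 2 < d" "97 / 100 * real r < e" "d + e - real r \<le> c" for c d e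
    using that r by (simp add: \<mu>_def)
  show ?thesis
  proof (rule extend_core_two_sided[where R = ?R and F = ?F and f\<^sub>0 = f\<^sub>0 and z = i\<^sub>1 and \<mu> = \<mu>
        and i\<^sub>1 = i\<^sub>1 and j\<^sub>1 = j\<^sub>1])
    fix i assume "i \<in> I - ?R"
    then obtain u where u: "u \<in> V i" "real r / 2 < deg u" using ex_deg_gt by blast
    have "\<mu> \<le> codeg u a - 2" using u(2) a(3) codeg_ge by (rule bound)
    also have "\<dots> = codeg u a - real (card ?F)" using j2(2) by simp
    also have "\<dots> \<le> (\<Sum>j\<in>J - ?F. share j (nb u j \<inter> nb (f\<^sub>0 i\<^sub>1) j))"
      using b(1) j2(1) by (intro codeg_le_sum_Diff) (auto simp: f0)
    finally show "\<exists>u\<in>V i. \<mu> \<le> (\<Sum>j\<in>J - ?F. share j (nb u j \<inter> nb (f\<^sub>0 i\<^sub>1) j))" using u(1) by blast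
  next
    fix j assume "j \<in> J - ?F"
    then obtain u where u: "u \<in> V j" "real r / 2 < swap.deg u" using swap.ex_deg_gt by blast
    have "\<mu> \<le> swap.codeg u b - 2" using u(2) b(3) swap.codeg_ge by (rule bound)
    also have "\<dots> = swap.codeg u b - real (card ?R)" using i2(2) by simp
    also have "\<dots> \<le> (\<Sum>i\<in>I - ?R. share i (nb u i \<inter> nb (f\<^sub>0 j\<^sub>1) i))"
      using a(1) i2(1) by (intro swap.codeg_le_sum_Diff) (auto simp: f0)
    finally show "\<exists>u\<in>V j. \<mu> \<le> (\<Sum>i\<in>I - ?R. share i (nb u i \<inter> nb (f\<^sub>0 j\<^sub>1) i))" using u(1) by blast
  qed (use a b i2 j2 x y reach f0 exp_beats_linear[OF r] in \<open>auto simp: \<mu>_def\<close>)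
qed

theorem ex_connected_choice:
  assumes r: "r > 7000"
  shows "connected_choice E V (I \<union> J)"
proof -
  interpret swap: blowup E V J I r by (rule swapped)
  consider "\<forall>i\<in>I. \<forall>x\<in>V i. deg x \<le> 97 / 100 * real r"
    | "\<forall>j\<in>J. \<forall>y\<in>V j. swap.deg y \<le> 97 / 100 * real r"
    | i a j b where "i \<in> I" "a \<in> V i" "97 / 100 * real r < deg a"
      "j \<in> J" "b \<in> V j" "97 / 100 * real r < swap.deg b"
    by (meson not_less)
  then show ?thesis
  proof cases
    case 1 then show ?thesis using connected_choice_if_degrees_bounded[OF r] by blast
  next
    case 2 then show ?thesis using swap.connected_choice_if_degrees_bounded[OF r] by (simp add: Un_commute)
  next
    case 3 then show ?thesis using connected_choice_if_large_degrees[OF r] by blast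
  qed
qed

end

section \<open>Spanning trees\<close>

lemma pcas_nth_Suc:
  "pcas u p v \<Longrightarrow> Suc i < length p \<Longrightarrow> fst (p ! Suc i) = snd (p ! i)"
proof (induction p arbitrary: u i)
  case (Cons e p)
  show ?case
  proof (cases i)
    case 0
    then show ?thesis using Cons.prems by (cases p) auto
  next
    case (Suc k)
    then show ?thesis using Cons by auto
  qed
qed simp

lemma pcas_ends:
  "pcas u p v \<Longrightarrow> p \<noteq> [] \<Longrightarrow> fst (p ! 0) = u \<and> snd (p ! (length p - 1)) = v"
  by (induction p arbitrary: u) (auto simp: nth_Cons')

text \<open>The rank \<open>\<rho>\<close> strictly decreases from child to parent, which rules out
  loops.\<close>

lemma pair_graph_parent:
  fixes \<rho> :: "'a \<Rightarrow> nat"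
  assumes "finite P" "\<And>x. x \<in> P - {z} \<Longrightarrow> \<pi> x \<in> P \<and> \<rho> (\<pi> x) < \<rho> x"
  defines "T \<equiv> \<lparr>pverts = P, parcs = (\<lambda>x. (x, \<pi> x)) ` (P - {z}) \<union> (\<lambda>x. (\<pi> x, x)) ` (P - {z})\<rparr>"
  shows "pair_graph T"
proof
  show "symmetric (with_proj T)" unfolding symmetric_def sym_def by (auto simp: T_def)
  show "fst a \<in> pverts T" "snd a \<in> pverts T" "fst a \<noteq> snd a" if "a \<in> parcs T" for a
    using that assms(2) by (force simp: T_def)+
qed (use assms(1) in \<open>auto simp: T_def\<close>)

text \<open>
  A neighbour of a vertex of maximal rank on a cycle is its parent, so its two neighbours on the
  cycle coincide.
\<close>

lemma no_cycle_parent: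
  fixes \<rho> :: "'a \<Rightarrow> nat"
  assumes "\<And>x y. (x, y) \<in> parcs T \<Longrightarrow> \<rho> x < \<rho> y \<and> x = \<pi> y \<or> \<rho> y < \<rho> x \<and> y = \<pi> x"
    and cyc: "pre_digraph.cycle (with_proj T) p"
  shows "length p < 3"
proof (rule ccontr)
  assume "\<not> length p < 3"
  define n where "n = length p"
  have n: "n \<ge> 3" using \<open>\<not> _\<close> by (simp add: n_def)
  then have "p \<noteq> []" by (auto simp: n_def)
  obtain u where walk: "pre_digraph.awalk (with_proj T) u p u"
    and dist: "distinct (tl (pre_digraph.awalk_verts (with_proj T) u p))"
    using cyc by (auto simp: pre_digraph.cycle_def)
  have cas: "pcas u p u" and arcs: "set p \<subseteq> parcs T"
    using walk by (auto simp: pre_digraph.awalk_def cas_with_proj_eq)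
  \<comment> \<open>The vertex list of a walk is \<open>u\<close> followed by the heads of its arcs,
    so the heads along a cycle are distinct.\<close>
  have "tl (pawalk_verts u p) = map snd p"
    using pre_digraph.awalk_verts_conv'[of "with_proj T" u p u] cas n
    by (auto simp: cas_with_proj_eq awalk_verts_with_proj_eq)
  then have dist: "distinct (map snd p)" using dist by (simp add: awalk_verts_with_proj_eq)
  have ends: "fst (p ! 0) = u" "snd (p ! (n - 1)) = u"
    using pcas_ends[OF cas] \<open>p \<noteq> []\<close> by (auto simp: n_def)
  have step: "fst (p ! Suc i) = snd (p ! i)" if "Suc i < n" for i
    using pcas_nth_Suc[OF cas] that by (simp add: n_def)
  define M where "M = (\<lambda>i. \<rho> (snd (p ! i))) ` {..<n}"
  have "finite M" "M \<noteq> {}" using n by (simp_all add: M_def lessThan_empty_iff)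
  then have "Max M \<in> M" by (rule Max_in)
  then obtain i where i: "i < n" and "\<rho> (snd (p ! i)) = Max M" by (auto simp: M_def)
  then have max: "\<rho> (snd (p ! k)) \<le> \<rho> (snd (p ! i))" if "k < n" for k
    using Max_ge[OF \<open>finite M\<close>] that by (simp add: M_def)
  \<comment> \<open>Cyclic predecessor and successor of position \<open>i\<close>; they differ
    because \<open>n \<ge> 3\<close>.\<close>
  define before where "before = (if i = 0 then n - 1 else i - 1)"
  define after where "after = (if i = n - 1 then 0 else Suc i)"
  have lt: "before < n" "after < n" and neq: "before \<noteq> after"
    using n i by (auto simp: before_def after_def)
  have b: "fst (p ! i) = snd (p ! before)"
    using ends step[of "i - 1"] i by (cases i) (auto simp: before_def)
  have a: "fst (p ! after) = snd (p ! i)"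
    using ends step[of i] i by (auto simp: after_def)
  have in_arcs: "(fst (p ! k), snd (p ! k)) \<in> parcs T" if "k < n" for k
    using arcs that nth_mem[of k p] by (auto simp: n_def)
  \<comment> \<open>As the rank is maximal at position \<open>i\<close>, the vertex there cannot be
    the parent of its neighbour, so the neighbour is its parent.\<close>
  have "snd (p ! before) = \<pi> (snd (p ! i))"
    using assms(1)[OF in_arcs[OF i]] max[OF lt(1)] b by auto
  moreover have "snd (p ! after) = \<pi> (snd (p ! i))"
    using assms(1)[OF in_arcs[OF lt(2)]] max[OF lt(2)] a by auto
  ultimately have "map snd p ! before = map snd p ! after"
    using lt by (simp add: n_def)
  then show False
    using nth_eq_iff_index_eq[OF dist, of before after] lt neq by (simp add: n_def)
qed

text \<open>A breadth-first search tree: \<open>\<rho>\<close> is the distance from \<open>z\<close>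
  within \<open>P\<close>, and every other vertex takes as parent a neighbour closer to
  \<open>z\<close>.\<close>

lemma ex_spanning_tree:
  assumes "finite P" "z \<in> P" and reach: "\<And>x. x \<in> P \<Longrightarrow> (z, x) \<in> (A \<inter> P \<times> P)\<^sup>*" and "sym A"
  obtains T where "pair_graph T" "pverts T = P" "parcs T \<subseteq> A"
    "Digraph_Component.connected (with_proj T)"
    "\<And>p. pre_digraph.cycle (with_proj T) p \<Longrightarrow> length p < 3"
proof -
  define \<rho> where "\<rho> x = (LEAST n. (z, x) \<in> (A \<inter> P \<times> P) ^^ n)" for x
  have dist: "(z, x) \<in> (A \<inter> P \<times> P) ^^ \<rho> x" if "x \<in> P" for x
    using reach[OF that] unfolding \<rho>_def rtrancl_power by (metis LeastI_ex)
  have "\<exists>y. (y, x) \<in> A \<inter> P \<times> P \<and> \<rho> y < \<rho> x" if x: "x \<in> P - {z}" for x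
  proof (cases "\<rho> x")
    case 0
    then show ?thesis using dist[of x] x by auto
  next
    case (Suc n)
    then obtain y where "(z, y) \<in> (A \<inter> P \<times> P) ^^ n" "(y, x) \<in> A \<inter> P \<times> P"
      using dist[of x] x by auto
    moreover from this(1) have "\<rho> y \<le> n" unfolding \<rho>_def by (rule Least_le)
    ultimately show ?thesis using Suc by auto
  qed
  then obtain \<pi> where \<pi>: "\<And>x. x \<in> P - {z} \<Longrightarrow> (\<pi> x, x) \<in> A \<inter> P \<times> P \<and> \<rho> (\<pi> x) < \<rho> x"
    by metis
  define T where "T = \<lparr>pverts = P, parcs = (\<lambda>x. (x, \<pi> x)) ` (P - {z}) \<union> (\<lambda>x. (\<pi> x, x)) ` (P - {z})\<rparr>"
  interpret T: pair_graph T
    unfolding T_def using \<pi> by (intro pair_graph_parent[where \<rho> = \<rho>] assms(1)) auto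
  have reach_T: "reachable (with_proj T) z x" if "x \<in> P" for x
    using that
  proof (induction "\<rho> x" arbitrary: x rule: less_induct)
    case less
    show ?case
    proof (cases "x = z")
      case True
      have "z \<in> pverts T" using assms(2) by (simp add: T_def)
      then show ?thesis using True by simp
    next
      case False
      then have x: "x \<in> P - {z}" using less.prems by simp
      have "reachable (with_proj T) z (\<pi> x)" using less.hyps[of "\<pi> x"] \<pi>[OF x] by auto
      moreover have "(\<pi> x, x) \<in> parcs T" using x by (auto simp: T_def)
      ultimately show ?thesis by (rule T.reachable_adj_trans)
    qed
  qed
  show ?thesis
  proof (rule that)
    show "pair_graph T" by (rule T.pair_graph)
    show "pverts T = P" by (simp add: T_def)
    show "parcs T \<subseteq> A" using \<pi> \<open>sym A\<close> by (auto simp: T_def dest: symD)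
    \<comment> \<open>\<open>connected\<close> means strong connectivity of the symmetric closure.
      Since \<open>T\<close> is symmetric, this reduces to walking from one vertex back to
      \<open>z\<close> and on to the other.\<close>
    show "Digraph_Component.connected (with_proj T)"
      unfolding connected_def
    proof (rule strongly_connectedI)
      show "verts (with_proj (mk_symmetric (with_proj T))) \<noteq> {}" using assms(2) by (auto simp: T_def)
      fix x y
      assume "x \<in> verts (with_proj (mk_symmetric (with_proj T)))"
        "y \<in> verts (with_proj (mk_symmetric (with_proj T)))"
      then have "x \<in> P" "y \<in> P" by (simp_all add: T_def)
      then have "reachable (with_proj T) x y"
        using reach_T T.symmetric_reachable' T.reachable_trans by blast
      then show "reachable (with_proj (mk_symmetric (with_proj T))) x y"
        by (simp add: T.reachable_mk_symmetric_eq T.pair_sym_arcs)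
    qed
    show "length p < 3" if "pre_digraph.cycle (with_proj T) p" for p
      using that \<pi> by (rule_tac no_cycle_parent[where \<rho> = \<rho> and \<pi> = \<pi>]) (auto simp: T_def)
  qed
qed

lemma contains_copy_self:
  assumes "pair_graph S"
  shows "contains_copy S S"
proof -
  interpret pair_graph S by fact
  define h :: "('a, 'a \<times> 'a, 'a, 'a \<times> 'a) digraph_isomorphism"
    where "h = \<lparr>iso_verts = id, iso_arcs = id, iso_head = snd, iso_tail = fst\<rparr>"
  have "pre_digraph.digraph_isomorphism (with_proj S) h"
    unfolding pre_digraph.digraph_isomorphism_def using wf_digraph by (simp add: h_def)
  moreover have "with_proj S = app_iso h (with_proj S)"
    by (simp add: app_iso_def h_def with_proj_def)
  ultimately have "digraph_iso (with_proj S) (with_proj S)"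
    unfolding digraph_iso_def by blast
  then show ?thesis
    unfolding contains_copy_def using assms subgraph_refl by blast
qed

section \<open>The critical density\<close>

lemma has_tree_traversal:
  fixes H :: "'v pair_pre_digraph" and G :: "nat pair_pre_digraph"
  assumes r: "r > 7000" and H: "complete_bipartite_digraph r r (with_proj H)"
    and G: "partite_graph H G V"
    and dens: "\<And>u v. (u, v) \<in> parcs H \<Longrightarrow> 1 / 2 < edge_density G (V u) (V v)"
  shows "has_family_traversal H G V (trees (2 * r))"
proof -
  obtain I J where fin_H: "finite (pverts H)" and IJ: "pverts H = I \<union> J" "I \<inter> J = {}" "card I = r" "card J = r"
    and arcs_H: "parcs H = I \<times> J \<union> J \<times> I"
    using H unfolding complete_bipartite_digraph_pair_def by blast
  interpret G: pair_graph G using G by (simp add: partite_graph_def)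
  have verts_G: "pverts G = (\<Union>v\<in>I \<union> J. V v)" and disj_V: "disjoint_family_on V (I \<union> J)"
    and ne: "\<And>v. v \<in> I \<union> J \<Longrightarrow> V v \<noteq> {}"
    using G by (auto simp: partite_graph_def IJ)
  interpret blowup "\<lambda>x y. (x, y) \<in> parcs G" V I J r
  proof
    show "(x, y) \<in> parcs G \<longleftrightarrow> (y, x) \<in> parcs G" for x y using G.arcs_symmetric by blast
    show fin_V: "finite (V p)" if "p \<in> I \<union> J" for p
      using that verts_G G.pair_finite_verts by (metis UN_upper finite_subset)
    fix i j assume ij: "i \<in> I" "j \<in> J"
    have pos: "0 < card (V i)" "0 < card (V j)" using ij ne fin_V by (auto simp: card_gt_0_iff)
    have "{(x, y) \<in> V i \<times> V j. (x, y) \<in> parcs G} = parcs G \<inter> V i \<times> V j" by auto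
    then show "real (card (V i)) * real (card (V j)) / 2
        < real (card {(x, y) \<in> V i \<times> V j. (x, y) \<in> parcs G})"
      using dens[of i j] ij pos by (simp add: edge_density_def arcs_H field_simps)
  qed (use fin_H IJ ne in auto)
  obtain f z where f: "\<And>p. p \<in> I \<union> J \<Longrightarrow> f p \<in> V p" and z: "z \<in> I \<union> J"
    and reach: "\<And>p. p \<in> I \<union> J \<Longrightarrow> (z, p) \<in> (link (\<lambda>x y. (x, y) \<in> parcs G) f (I \<union> J))\<^sup>*"
    using ex_connected_choice[OF r] unfolding connected_choice_def by blast
  have f_eq: "p = q" if "p \<in> I \<union> J" "q \<in> I \<union> J" "f p \<in> V q" for p q
  proof (rule ccontr)
    assume "p \<noteq> q"
    then have "V p \<inter> V q = {}" using disj_V that(1,2) unfolding disjoint_family_on_def by simp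
    then show False using f[OF that(1)] that(3) by auto
  qed
  define P where "P = f ` (I \<union> J)"
  \<comment> \<open>Carries reachability over from the indices of the parts to the chosen
    vertices.\<close>
  have reach_P: "(f z, x) \<in> (parcs G \<inter> P \<times> P)\<^sup>*" if "x \<in> P" for x
  proof -
    have "(f z, f p) \<in> (parcs G \<inter> P \<times> P)\<^sup>*"
      if "(z, p) \<in> (link (\<lambda>x y. (x, y) \<in> parcs G) f (I \<union> J))\<^sup>*" for p
      using that
    proof (induction rule: rtrancl_induct)
      case (step p q)
      then have "(f p, f q) \<in> parcs G \<inter> P \<times> P" by (auto simp: link_def P_def)
      with step.IH show ?case by (rule rtrancl_into_rtrancl)
    qed simp
    then show ?thesis using that reach by (auto simp: P_def)
  qed
  have "finite P" "f z \<in> P" using fin_H IJ z by (auto simp: P_def)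
  moreover have "sym (parcs G)" using G.arcs_symmetric by (auto intro: symI)
  ultimately obtain T where T: "pair_graph T" "pverts T = P" "parcs T \<subseteq> parcs G"
    "Digraph_Component.connected (with_proj T)"
    "\<And>p. pre_digraph.cycle (with_proj T) p \<Longrightarrow> length p < 3"
    using ex_spanning_tree[of P "f z" "parcs G"] reach_P by metis
  have "inj_on f (I \<union> J)" using f f_eq by (metis inj_onI)
  then have "card P = 2 * r"
    using IJ fin_H by (simp add: P_def card_image card_Un_disjoint)
  then have "T \<in> trees (2 * r)"
    using T by (auto simp: trees_def not_le)
  moreover have "traversal H G V T"
    unfolding traversal_def
  proof (intro conjI ballI)
    show "pair_graph T" by fact
    then interpret T: pair_graph T .
    have "P \<subseteq> pverts G" using f verts_G by (auto simp: P_def)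
    then show "subgraph (with_proj T) (with_proj G)"
      unfolding subgraph_def using T(2,3) G.wf_digraph T.wf_digraph by auto
    fix v assume v: "v \<in> pverts H"
    show "\<exists>!x. x \<in> pverts T \<inter> V v"
    proof (rule ex1I)
      show "f v \<in> pverts T \<inter> V v" using v f IJ(1) T(2) by (auto simp: P_def)
      show "x = f v" if x: "x \<in> pverts T \<inter> V v" for x
      proof -
        obtain p where "p \<in> I \<union> J" "x = f p" using x T(2) by (auto simp: P_def)
        then show ?thesis using f_eq[of p v] x v IJ(1) by simp
      qed
    qed
  qed
  \<comment> \<open>A traversal need not be induced, so \<open>T\<close> serves both as the
    traversal and as the member of the family that it contains.\<close>
  ultimately show ?thesis
    unfolding has_family_traversal_def using contains_copy_self T(1) by blast
qed

section \<open>Lower bound: a disconnected graph of density one half\<close>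

lemma traversal_card:
  assumes "partite_graph H G V" "traversal H G V S"
  shows "card (pverts S) = card (pverts H)"
proof -
  have sub: "pverts S \<subseteq> (\<Union>v\<in>pverts H. V v)" and disj: "disjoint_family_on V (pverts H)"
    using assms by (auto simp: partite_graph_def traversal_def subgraph_def)
  have ex1: "\<exists>!x. x \<in> pverts S \<inter> V v" if "v \<in> pverts H" for v
    using assms(2) that by (auto simp: traversal_def)
  define f where "f v = (THE x. x \<in> pverts S \<inter> V v)" for v
  have f: "f v \<in> pverts S \<inter> V v" if "v \<in> pverts H" for v
    unfolding f_def by (rule theI') (rule ex1[OF that])
  have "inj_on f (pverts H)"
  proof (rule inj_onI)
    fix u v assume "u \<in> pverts H" "v \<in> pverts H" "f u = f v"
    then show "u = v" using f[of u] f[of v] disj by (auto simp: disjoint_family_on_def)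
  qed
  moreover have "f ` pverts H = pverts S"
  proof
    show "f ` pverts H \<subseteq> pverts S" using f by auto
    show "pverts S \<subseteq> f ` pverts H"
    proof
      fix x assume "x \<in> pverts S"
      then obtain v where v: "v \<in> pverts H" "x \<in> pverts S \<inter> V v" using sub by blast
      then have "x = f v" using ex1[OF v(1)] f[OF v(1)] by blast
      then show "x \<in> f ` pverts H" using v(1) by blast
    qed
  qed
  ultimately show ?thesis using card_image by metis
qed

lemma closed_set_in_connected:
  assumes conn: "Digraph_Component.connected (with_proj F)" and "pair_graph F"
    and closed: "\<And>x y. (x, y) \<in> parcs F \<Longrightarrow> x \<in> Z \<longleftrightarrow> y \<in> Z"
    and "x \<in> pverts F" "y \<in> pverts F" "x \<in> Z"
  shows "y \<in> Z"
proof -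
  interpret F: pair_graph F by fact
  have "reachable (with_proj (mk_symmetric (with_proj F))) x y"
    using conn assms(4,5) by (auto simp: connected_def strongly_connected_def)
  then have "reachable (with_proj F) x y"
    by (simp add: F.reachable_mk_symmetric_eq F.pair_sym_arcs)
  then show ?thesis
    by (induction rule: F.reachable_induct) (use closed \<open>x \<in> Z\<close> in auto)
qed

text \<open>A copy of a tree on \<open>m\<close> vertices uses every vertex of a traversal, in
  particular those in \<open>V u\<close> and \<open>V v\<close>. These lie on different sides of
  \<open>Z\<close>, which no edge crosses, contradicting connectedness.\<close>

lemma no_tree_traversal_if_closed:
  fixes G :: "nat pair_pre_digraph"
  assumes G: "partite_graph H G V" and m: "card (pverts H) = m"
    and closed: "\<And>x y. (x, y) \<in> parcs G \<Longrightarrow> x \<in> Z \<longleftrightarrow> y \<in> Z"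
    and "u \<in> pverts H" "V u \<subseteq> Z" "v \<in> pverts H" "V v \<inter> Z = {}"
  shows "\<not> has_family_traversal H G V (trees m)"
proof
  assume "has_family_traversal H G V (trees m)"
  then obtain S F F' where S: "traversal H G V S" and F: "F \<in> trees m"
    and F': "pair_graph F'" "subgraph (with_proj F') (with_proj S)" "digraph_iso (with_proj F) (with_proj F')"
    unfolding has_family_traversal_def contains_copy_def by blast
  have "pair_graph F" and conn: "Digraph_Component.connected (with_proj F)" and card_F: "card (pverts F) = m"
    using F by (auto simp: trees_def)
  interpret F: pair_graph F by fact
  interpret S: pair_graph S using S by (simp add: traversal_def)
  obtain h where h: "pre_digraph.digraph_isomorphism (with_proj F) h"
    and F'_eq: "with_proj F' = app_iso h (with_proj F)"
    using F'(3) by (auto simp: digraph_iso_def)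
  have verts_F': "pverts F' = iso_verts h ` pverts F" and arcs_F': "parcs F' = iso_arcs h ` parcs F"
    and fst_F': "iso_tail h = fst" and snd_F': "iso_head h = snd"
    using arg_cong[OF F'_eq, of verts] arg_cong[OF F'_eq, of arcs]
      arg_cong[OF F'_eq, of tail] arg_cong[OF F'_eq, of head] by simp_all
  have "card (pverts F') = m"
    using h card_F unfolding verts_F' pre_digraph.digraph_isomorphism_def by (simp add: card_image)
  moreover have "pverts F' \<subseteq> pverts S" "parcs F' \<subseteq> parcs S" using F'(2) by (auto simp: subgraph_def)
  ultimately have F'_S: "pverts F' = pverts S"
    using traversal_card[OF G S] m S.pair_finite_verts by (metis card_subset_eq)
  have arcs_G: "parcs F' \<subseteq> parcs G"
    using \<open>parcs F' \<subseteq> parcs S\<close> S by (auto simp: traversal_def subgraph_def)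
  have arc: "(iso_verts h x, iso_verts h y) \<in> parcs G" if "(x, y) \<in> parcs F" for x y
  proof -
    \<comment> \<open>An isomorphism maps arcs by a function of its own; compatibility with tails
      and heads, which are \<open>fst\<close> and \<open>snd\<close> on the image, forces it to act
      as the vertex map on both ends.\<close>
    have "iso_arcs h (x, y) = (iso_verts h x, iso_verts h y)"
      using h that fst_F' snd_F' by (auto simp: pre_digraph.digraph_isomorphism_def prod_eq_iff)
    then show ?thesis using that arcs_F' arcs_G by (metis imageI subsetD)
  qed
  obtain a b where "a \<in> pverts S \<inter> V u" "b \<in> pverts S \<inter> V v"
    using S assms(4,6) unfolding traversal_def by blast
  then obtain x y where "x \<in> pverts F" "a = iso_verts h x" "y \<in> pverts F" "b = iso_verts h y"
    using F'_S verts_F' by blast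
  then have "iso_verts h y \<in> Z"
    using closed_set_in_connected[OF conn \<open>pair_graph F\<close>, of "{x. iso_verts h x \<in> Z}" x y]
      closed[OF arc] assms(5) \<open>a \<in> _\<close> by auto
  then show False using \<open>b \<in> _\<close> \<open>b = _\<close> assms(7) by auto
qed

text \<open>Each row vertex sees exactly one of the two vertices of every column, so all densities
  are 1/2. A second row, available by \<open>r \<ge> 2\<close>, lies outside the component of row
  \<open>i\<^sub>0\<close>.\<close>

lemma ex_half_density:
  fixes H :: "'v pair_pre_digraph"
  assumes r: "r \<ge> 2" and H: "complete_bipartite_digraph r r (with_proj H)"
  obtains G :: "nat pair_pre_digraph" and V
  where "partite_graph H G V" "partite_density H G V = 1 / 2" "\<not> has_family_traversal H G V (trees (2 * r))"
proof -
  obtain I J where fin_H: "finite (pverts H)" and IJ: "pverts H = I \<union> J" "I \<inter> J = {}" "card I = r" "card J = r"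
    and arcs_H: "parcs H = I \<times> J \<union> J \<times> I"
    using H unfolding complete_bipartite_digraph_pair_def by blast
  have fin: "finite I" "finite J" using fin_H IJ by auto
  obtain e :: "'v \<Rightarrow> nat" where e: "inj_on e (pverts H)"
    using finite_imp_inj_to_nat_seg fin_H by metis
  have "\<not> card I \<le> 1" using IJ(3) r by simp
  then obtain i\<^sub>0 i\<^sub>1 where i0: "i\<^sub>0 \<in> I" and i1: "i\<^sub>1 \<in> I" "i\<^sub>1 \<noteq> i\<^sub>0"
    using card_le_Suc0_iff_eq[OF fin(1)] by auto
  have "card J \<noteq> 0" using IJ(4) r by simp
  then obtain j\<^sub>0 where j0: "j\<^sub>0 \<in> J" by fastforce
  have e_eq: "p = q" if "e p = e q" "p \<in> I \<union> J" "q \<in> I \<union> J" for p q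
    using e that IJ(1) by (auto dest: inj_onD)
  \<comment> \<open>Halving a vertex recovers the injective code \<open>e p\<close> of its part,
    which makes the parts disjoint. A column has an even and an odd vertex.\<close>
  define V where "V p = (if p \<in> I then {2 * e p} else {2 * e p, 2 * e p + 1})" for p
  \<comment> \<open>The only neighbour of row \<open>i\<close> in column \<open>j\<close>: the even
    vertex for \<open>i\<^sub>0\<close>, the odd one for every other row.\<close>
  define t where "t i j = 2 * e j + (if i = i\<^sub>0 then 0 else 1)" for i j
  define A where "A = (\<lambda>(i, j). (2 * e i, t i j)) ` (I \<times> J)"
  define G where "G = \<lparr>pverts = (\<Union>p\<in>pverts H. V p), parcs = A \<union> A\<inverse>\<rparr>"
  have V_I: "V i = {2 * e i}" if "i \<in> I" for i using that by (simp add: V_def)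
  have V_J: "V j = {2 * e j, 2 * e j + 1}" if "j \<in> J" for j using that IJ(2) by (auto simp: V_def)
  have V_e: "e p = x div 2" if "x \<in> V p" for p x using that by (auto simp: V_def split: if_splits)
  have V_eq: "p = q" if "x \<in> V p" "x \<in> V q" "p \<in> I \<union> J" "q \<in> I \<union> J" for p q x
    using V_e that by (metis e_eq)
  have t_V: "t i j \<in> V j" if "j \<in> J" for i j using V_J[OF that] by (simp add: t_def)
  have A_iff: "(x, y) \<in> A \<longleftrightarrow> (\<exists>i\<in>I. \<exists>j\<in>J. x = 2 * e i \<and> y = t i j)" for x y
    by (auto simp: A_def)
  have e_V: "2 * e i \<in> V i" if "i \<in> I" for i using V_I[OF that] by simp
  have A_parts: "\<exists>i\<in>I. \<exists>j\<in>J. x \<in> V i \<and> y \<in> V j" if xy: "(x, y) \<in> A" for x y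
  proof -
    obtain i j where "i \<in> I" "j \<in> J" "x = 2 * e i" "y = t i j" 
      using iffD1[OF A_iff xy] by blast
    then have "x \<in> V i" "y \<in> V j" using e_V[of i] t_V[of j i] by simp_all
    then show ?thesis using \<open>i \<in> I\<close> \<open>j \<in> J\<close> by blast
  qed
  have A_I: "A \<inter> V i \<times> V j = {(2 * e i, t i j)}" if ij: "i \<in> I" "j \<in> J" for i j
  proof -
    have uniq: "x = 2 * e i \<and> y = t i j" if xy: "(x, y) \<in> A" "x \<in> V i" "y \<in> V j" for x y
    proof -
      obtain i' j' where "i' \<in> I" "j' \<in> J" "x = 2 * e i'" "y = t i' j'"
        using iffD1[OF A_iff xy(1)] by blast
      moreover from this have "i' = i" "j' = j"
        using V_eq[of x i' i] V_eq[of y j' j] e_V[of i'] t_V[of j' i'] xy(2,3) ij by simp_all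
      ultimately show ?thesis by simp
    qed
    have "(2 * e i, t i j) \<in> A" using ij unfolding A_def by (intro image_eqI[where x = "(i, j)"]) auto
    then have "(2 * e i, t i j) \<in> A \<inter> V i \<times> V j" using e_V[OF ij(1)] t_V[OF ij(2)] by simp
    moreover have "p = (2 * e i, t i j)" if p: "p \<in> A \<inter> V i \<times> V j" for p
      using uniq[of "fst p" "snd p"] p by (cases p) simp
    ultimately show ?thesis by blast
  qed
  have A_not: "i \<in> I \<and> j \<in> J" if xy: "(x, y) \<in> A" "x \<in> V i" "y \<in> V j" "i \<in> I \<union> J" "j \<in> I \<union> J" for i j x y
  proof -
    obtain i' j' where "i' \<in> I" "j' \<in> J" "x \<in> V i'" "y \<in> V j'" using A_parts[OF xy(1)] by blast
    then show ?thesis using V_eq[of x i' i] V_eq[of y j' j] xy by auto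
  qed
  have part: "partite_graph H G V"
    unfolding partite_graph_def
  proof (intro conjI ballI impI)
    have A_fin: "finite A" using fin by (auto simp: A_def)
    have A_verts: "x \<in> pverts G \<and> y \<in> pverts G" if "(x, y) \<in> A" for x y
      using A_parts[OF that] IJ(1) by (auto simp: G_def)
    have A_neq: "x \<noteq> y" if xy: "(x, y) \<in> A" for x y
    proof
      assume "x = y"
      moreover obtain i j where "i \<in> I" "j \<in> J" "x \<in> V i" "y \<in> V j" using A_parts[OF xy] by blast
      ultimately show False using V_eq[of x i j] IJ(2) by auto
    qed
    show "pair_graph G"
    proof
      show "symmetric (with_proj G)" unfolding symmetric_def sym_def by (auto simp: G_def)
      show "fst a \<in> pverts G" "snd a \<in> pverts G" "fst a \<noteq> snd a" if "a \<in> parcs G" for a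
      proof -
        have "(fst a, snd a) \<in> A \<or> (snd a, fst a) \<in> A" using that by (auto simp: G_def)
        then show "fst a \<in> pverts G" "snd a \<in> pverts G" "fst a \<noteq> snd a"
          using A_verts A_neq by metis+
      qed
      show "finite (pverts G)" using fin_H by (auto simp: G_def V_def)
      show "finite (parcs G)" using A_fin by (auto simp: G_def)
    qed
    show "pverts G = (\<Union>v\<in>pverts H. V v)" by (simp add: G_def)
    show "disjoint_family_on V (pverts H)"
      unfolding disjoint_family_on_def IJ(1)
    proof (intro ballI impI)
      fix p q assume "p \<in> I \<union> J" "q \<in> I \<union> J" "p \<noteq> q"
      then show "V p \<inter> V q = {}" using V_eq[of _ p q] by blast
    qed
    show "V v \<noteq> {}" for v by (simp add: V_def)
    show "parcs G \<inter> V v \<times> V v = {}" if "v \<in> pverts H" for v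
      using A_not[of _ _ v v] that IJ(1,2) by (auto simp: G_def)
    show "parcs G \<inter> V u \<times> V v = {}"
      if "u \<in> pverts H" "v \<in> pverts H" "u \<noteq> v \<and> (u, v) \<notin> parcs H" for u v
      using A_not[of _ _ u v] A_not[of _ _ v u] that IJ(1) arcs_H by (auto simp: G_def)
  qed
  have dens_IJ: "edge_density G (V i) (V j) = 1 / 2" "edge_density G (V j) (V i) = 1 / 2"
    if ij: "i \<in> I" "j \<in> J" for i j
  proof -
    have not: "A \<inter> V j \<times> V i = {}" using A_not[of _ _ j i] ij IJ(2) by blast
    have "parcs G \<inter> V i \<times> V j = A \<inter> V i \<times> V j \<union> (A \<inter> V j \<times> V i)\<inverse>" by (auto simp: G_def)
    then show "edge_density G (V i) (V j) = 1 / 2"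
      using A_I[OF ij] not V_I[OF ij(1)] V_J[OF ij(2)] by (simp add: edge_density_def)
    have "parcs G \<inter> V j \<times> V i = A \<inter> V j \<times> V i \<union> (A \<inter> V i \<times> V j)\<inverse>" by (auto simp: G_def)
    then show "edge_density G (V j) (V i) = 1 / 2"
      using A_I[OF ij] not V_I[OF ij(1)] V_J[OF ij(2)] by (simp add: edge_density_def)
  qed
  have "(case p of (u, v) \<Rightarrow> edge_density G (V u) (V v)) = 1 / 2" if "p \<in> parcs H" for p
    using that dens_IJ arcs_H by (cases p) auto
  then have "(\<lambda>(u, v). edge_density G (V u) (V v)) ` parcs H = (\<lambda>_. 1 / 2) ` parcs H"
    by (intro image_cong refl)
  moreover have "(i\<^sub>0, j\<^sub>0) \<in> parcs H" using arcs_H i0 j0 by simp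
  ultimately have "(\<lambda>(u, v). edge_density G (V u) (V v)) ` parcs H = {1 / 2}" by (simp add: image_constant)
  then have dens: "partite_density H G V = 1 / 2" by (simp add: partite_density_def)
  \<comment> \<open>The connected component of row \<open>i\<^sub>0\<close>: its vertex and the even
    vertices of all columns.\<close>
  define Z where "Z = insert (2 * e i\<^sub>0) ((\<lambda>j. 2 * e j) ` J)"
  \<comment> \<open>Row vertices are even as well; injectivity of \<open>e\<close> on
    \<open>I \<union> J\<close> keeps them apart from the even column vertices.\<close>
  have Z_I: "2 * e i \<in> Z \<longleftrightarrow> i = i\<^sub>0" if "i \<in> I" for i
    using that i0 IJ(2) e_eq[of i] by (auto simp: Z_def)
  have Z_t: "t i j \<in> Z \<longleftrightarrow> i = i\<^sub>0" if "j \<in> J" for i j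
  proof (cases "i = i\<^sub>0")
    case True
    then show ?thesis using that by (simp add: t_def Z_def)
  next
    case False
    then have "odd (t i j)" by (simp add: t_def)
    moreover have "even z" if "z \<in> Z" for z using that by (auto simp: Z_def)
    ultimately show ?thesis using False by blast
  qed
  have "\<not> has_family_traversal H G V (trees (2 * r))"
  proof (rule no_tree_traversal_if_closed[OF part])
    show "card (pverts H) = 2 * r" using IJ fin by (simp add: card_Un_disjoint)
    show "x \<in> Z \<longleftrightarrow> y \<in> Z" if "(x, y) \<in> parcs G" for x y
    proof -
      have "(x, y) \<in> A \<or> (y, x) \<in> A" using that by (auto simp: G_def)
      then obtain i j where "i \<in> I" "j \<in> J" "x = 2 * e i \<and> y = t i j \<or> y = 2 * e i \<and> x = t i j"
        using A_iff by meson
      then show ?thesis using Z_I[of i] Z_t[of j i] by auto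
    qed
    show "V i\<^sub>0 \<subseteq> Z" using Z_I[OF i0] V_I[OF i0] by simp
    show "V i\<^sub>1 \<inter> Z = {}" using Z_I[OF i1(1)] V_I[OF i1(1)] i1(2) by simp
  qed (use i0 i1 IJ in auto)
  then show ?thesis using that part dens by blast
qed

theorem theorem1p3:
  fixes r :: nat and H :: "'v pair_pre_digraph"
  assumes "r > 7000"
    and "complete_bipartite_digraph r r (with_proj H)"
  shows "critical_density H (trees (2 * r)) = 1 / 2"
  unfolding critical_density_def
\<comment> \<open>The construction attains 1/2, so the supremum is a maximum, and it remains to
  bound each admissible \<alpha>.\<close>
proof (rule cSup_eq_maximum)
  obtain G :: "nat pair_pre_digraph" and V where "partite_graph H G V" "partite_density H G V = 1 / 2"
    "\<not> has_family_traversal H G V (trees (2 * r))"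
    using ex_half_density[of r H] assms by auto
  then have "\<exists>(G :: nat pair_pre_digraph) V. partite_graph H G V \<and>
      partite_density H G V \<ge> 1 / 2 \<and> \<not> has_family_traversal H G V (trees (2 * r))"
    by (metis order_refl)
  then show "1 / 2 \<in> {\<alpha> \<in> {0..1}. \<exists>(G :: nat pair_pre_digraph) V. partite_graph H G V \<and>
      partite_density H G V \<ge> \<alpha> \<and> \<not> has_family_traversal H G V (trees (2 * r))}"
    by simp
  fix \<alpha> :: real
  assume "\<alpha> \<in> {\<alpha> \<in> {0..1}. \<exists>(G :: nat pair_pre_digraph) V. partite_graph H G V \<and>
      partite_density H G V \<ge> \<alpha> \<and> \<not> has_family_traversal H G V (trees (2 * r))}"
  then obtain G :: "nat pair_pre_digraph" and V where G: "partite_graph H G V" "\<alpha> \<le> partite_density H G V"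
    and no: "\<not> has_family_traversal H G V (trees (2 * r))" by blast
  show "\<alpha> \<le> 1 / 2"
  proof (rule ccontr)
    assume "\<not> \<alpha> \<le> 1 / 2"
    interpret H: pair_graph H
      using assms(2) by (rule pair_graphI_complete_bipartite)
    have "1 / 2 < edge_density G (V u) (V v)" if "(u, v) \<in> parcs H" for u v
    proof -
      have "partite_density H G V \<le> edge_density G (V u) (V v)"
        unfolding partite_density_def
      proof (rule Min_le)
        show "finite ((\<lambda>(u, v). edge_density G (V u) (V v)) ` parcs H)"
          by (rule finite_imageI) (rule H.pair_finite_arcs)
        show "edge_density G (V u) (V v) \<in> (\<lambda>(u, v). edge_density G (V u) (V v)) ` parcs H"
          using that by (rule rev_image_eqI) simp
      qed
      then show ?thesis using G(2) \<open>\<not> \<alpha> \<le> 1 / 2\<close> by linarith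
    qed
    then show False using has_tree_traversal[OF assms G(1)] no by blast
  qed
qed

end
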